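(* Let $R\subseteq T$ be rings forming a regular conductor square with conductor $C$, and set $A=R/C$, $B=T/C$. Assume that $T$ is flat as an $R$-module, that $C$ is a principal ideal of $T$, and that every non-zero finitely generated ideal $I$ of $R$ satisfies the following condition: there is an ideal $I'$ of $R$ isomorphic to $I$ (as an $R$-module) such that $I'T=T$. Assume that $A$ is a finite product of integral domains. If $A$ is quasi-coherent, then $R$ and $T$ are quasi-coherent as well.
   Context: All rings are commutative with identity. A conductor square consists of a ring $T$, a subring $R\subseteq T$ such that $R$ and $T$ have a common non-zero ideal, the largest common ideal $C$ of $R$ and $T$ (called the conductor of $T$ into $R$), and the rings $A=R/C$ and $B=T/C$, together with the inclusions $R\hookrightarrow T$, $A\hookrightarrow B$ and the projections $\eta_2\colon R\twoheadrightarrow A$, $\eta_1\colon T\twoheadrightarrow B$; equivalently, $R$ is the pullback $\{(a,t)\in A\times T\mid a=\eta_1(t)\text{ in }B\}$ and $C=\operatorname{Ker}(\eta_1)=\operatorname{Ker}(\eta_2)$ is the largest common ideal. The square is regular if $C$ contains a non-zero-divisor of $T$. A ring $S$ is quasi-coherent if every ideal of the form $(0:_S a)=\{x\in S\mid xa=0\}$ with $a\in S$ is finitely generated, and every intersection of finitely many principal ideals of $S$ is finitely generated. *)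

theory Defs
  imports
    "HOL-Algebra.Algebra"
    "HOL-Algebra.Chinese_Remainder"
    "HOL-Algebra.Free_Abelian_Groups"
begin

section \<open>Finitely generated ideals and quasi-coherent rings\<close>

definition finitely_generated_ideal :: "'a set \<Rightarrow> ('a, 'b) ring_scheme \<Rightarrow> bool" where
  "finitely_generated_ideal I S \<longleftrightarrow>
     (\<exists>F. finite F \<and> F \<subseteq> carrier S \<and> I = Idl\<^bsub>S\<^esub> F)"

definition annihilator :: "('a, 'b) ring_scheme \<Rightarrow> 'a \<Rightarrow> 'a set" where
  "annihilator S a = {x \<in> carrier S. x \<otimes>\<^bsub>S\<^esub> a = \<zero>\<^bsub>S\<^esub>}"

text \<open>
  The index set \<open>F\<close> is required to be non-empty only because \<open>\<Inter>{}\<close> is \<open>UNIV\<close>; the empty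
  intersection of ideals, \<open>carrier S\<close>, is principal anyway.
\<close>

definition quasi_coherent :: "('a, 'b) ring_scheme \<Rightarrow> bool" where
  "quasi_coherent S \<longleftrightarrow>
     (\<forall>a \<in> carrier S. finitely_generated_ideal (annihilator S a) S) \<and>
     (\<forall>F. finite F \<and> F \<noteq> {} \<and> F \<subseteq> carrier S \<longrightarrow>
          finitely_generated_ideal (\<Inter>a\<in>F. PIdl\<^bsub>S\<^esub> a) S)"

definition non_zero_divisor :: "('a, 'b) ring_scheme \<Rightarrow> 'a \<Rightarrow> bool" where
  "non_zero_divisor S c \<longleftrightarrow>
     c \<in> carrier S \<and> (\<forall>x \<in> carrier S. x \<otimes>\<^bsub>S\<^esub> c = \<zero>\<^bsub>S\<^esub> \<longrightarrow> x = \<zero>\<^bsub>S\<^esub>)"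


section \<open>Conductor squares\<close>

text \<open>
  The remaining corners of the square are \<open>R Quot C\<close> and \<open>T Quot C\<close>, and its maps are the
  canonical ones, so the square is determined by \<open>R\<close>, \<open>T\<close> and \<open>C\<close>.
\<close>

locale conductor_square = T?: cring T
  for R :: "'a ring" and T :: "'a ring" and C :: "'a set" +
  assumes R_subring: "subring (carrier R) T"
    and R_operations: "R = T\<lparr>carrier := carrier R\<rparr>"
    and C_common: "ideal C R" "ideal C T"
    and C_nonzero: "C \<noteq> {\<zero>\<^bsub>T\<^esub>}"
    and C_largest: "\<And>J. ideal J R \<Longrightarrow> ideal J T \<Longrightarrow> J \<subseteq> C"

locale regular_conductor_square = conductor_square +
  assumes regular: "\<exists>c \<in> C. non_zero_divisor T c"


section \<open>Modules\<close>

text \<open>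
  A set \<open>U\<close> of elements of \<open>S\<close> as a module whose scalars act by the multiplication of \<open>S\<close>.
  It is used for an ideal of a ring as a module over that ring, and for \<open>T\<close> as a module over
  a subring. The fields \<open>mult\<close> and \<open>one\<close>, which are part of the record type, are irrelevant
  to the locale \<open>module\<close>.
\<close>

definition mult_module :: "'a ring \<Rightarrow> 'a set \<Rightarrow> ('a, 'a) module" where
  "mult_module S U =
     \<lparr>carrier = U, monoid.mult = monoid.mult S, one = one S, ring.zero = ring.zero S,
      add = add S, smult = monoid.mult S\<rparr>"

definition module_hom ::
  "'a ring \<Rightarrow> ('a, 'm) module \<Rightarrow> ('a, 'n) module \<Rightarrow> ('m \<Rightarrow> 'n) set" where
  "module_hom R M N =
     {f \<in> carrier M \<rightarrow> carrier N.
        (\<forall>x \<in> carrier M. \<forall>y \<in> carrier M. f (x \<oplus>\<^bsub>M\<^esub> y) = f x \<oplus>\<^bsub>N\<^esub> f y) \<and>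
        (\<forall>r \<in> carrier R. \<forall>x \<in> carrier M. f (r \<odot>\<^bsub>M\<^esub> x) = r \<odot>\<^bsub>N\<^esub> f x)}"

definition module_isomorphic ::
  "'a ring \<Rightarrow> ('a, 'm) module \<Rightarrow> ('a, 'n) module \<Rightarrow> bool" where
  "module_isomorphic R M N \<longleftrightarrow>
     (\<exists>f \<in> module_hom R M N. bij_betw f (carrier M) (carrier N))"


section \<open>Tensor products and flatness\<close>

text \<open>
  The underlying abelian group of the tensor product of \<open>M\<close> and \<open>N\<close> over \<open>R\<close>: the free abelian
  group on the pairs modulo the subgroup generated by the bilinearity relations. The module
  structure on it is not needed to say that an induced map is injective.
\<close>

definition tensor_relations ::
  "'a ring \<Rightarrow> ('a, 'm) module \<Rightarrow> ('a, 'n) module \<Rightarrow> ('m \<times> 'n \<Rightarrow>\<^sub>0 int) set" where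
  "tensor_relations R M N =
     {frag_of (x \<oplus>\<^bsub>M\<^esub> x', y) - frag_of (x, y) - frag_of (x', y) | x x' y.
        x \<in> carrier M \<and> x' \<in> carrier M \<and> y \<in> carrier N} \<union>
     {frag_of (x, y \<oplus>\<^bsub>N\<^esub> y') - frag_of (x, y) - frag_of (x, y') | x y y'.
        x \<in> carrier M \<and> y \<in> carrier N \<and> y' \<in> carrier N} \<union>
     {frag_of (r \<odot>\<^bsub>M\<^esub> x, y) - frag_of (x, r \<odot>\<^bsub>N\<^esub> y) | r x y.
        r \<in> carrier R \<and> x \<in> carrier M \<and> y \<in> carrier N}"

definition tensor_subgroup ::
  "'a ring \<Rightarrow> ('a, 'm) module \<Rightarrow> ('a, 'n) module \<Rightarrow> ('m \<times> 'n \<Rightarrow>\<^sub>0 int) set" where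
  "tensor_subgroup R M N =
     generate (free_Abelian_group (carrier M \<times> carrier N)) (tensor_relations R M N)"

definition tensor_product ::
  "'a ring \<Rightarrow> ('a, 'm) module \<Rightarrow> ('a, 'n) module \<Rightarrow> ('m \<times> 'n \<Rightarrow>\<^sub>0 int) set monoid" where
  "tensor_product R M N =
     free_Abelian_group (carrier M \<times> carrier N) Mod tensor_subgroup R M N"

text \<open>
  The map induced by the identity of \<open>M\<close> and a module homomorphism \<open>f\<close> from \<open>N\<close> to \<open>N'\<close>. It is
  defined on cosets: the image of a coset under the induced map of free abelian groups lies in a
  single coset, which is recovered by adding the relations of the target.
\<close>

definition tensor_map ::
  "'a ring \<Rightarrow> ('a, 'm) module \<Rightarrow> ('a, 'p) module \<Rightarrow> ('n \<Rightarrow> 'p) \<Rightarrow>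
     ('m \<times> 'n \<Rightarrow>\<^sub>0 int) set \<Rightarrow> ('m \<times> 'p \<Rightarrow>\<^sub>0 int) set" where
  "tensor_map R M N' f U =
     tensor_subgroup R M N' <#>\<^bsub>free_Abelian_group (carrier M \<times> carrier N')\<^esub>
       (frag_extend (\<lambda>(x, y). frag_of (x, f y)) ` U)"

text \<open>
  Flatness: tensoring with \<open>M\<close> preserves injectivity of homomorphisms. HOL cannot quantify over
  the types of the modules \<open>N\<close>, \<open>N'\<close> inside a definition, so they are taken with elements in
  \<^typ>\<open>(nat \<Rightarrow> 'a) set\<close>. Every countably generated \<open>R\<close>-module is isomorphic to one of these: it is
  a quotient of the module of finitely supported sequences in \<open>R\<close>, whose elements are cosets.
  This is no restriction, since it is classical that flatness can be tested on finitely
  generated modules, or just on the inclusions of finitely generated ideals into \<open>R\<close>.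
\<close>

definition flat_module :: "'a ring \<Rightarrow> ('a, 'm) module \<Rightarrow> bool" where
  "flat_module R M \<longleftrightarrow>
     module R M \<and>
     (\<forall>(N :: ('a, (nat \<Rightarrow> 'a) set) module) (N' :: ('a, (nat \<Rightarrow> 'a) set) module) f.
        module R N \<and> module R N' \<and> f \<in> module_hom R N N' \<and> inj_on f (carrier N) \<longrightarrow>
        inj_on (tensor_map R M N' f) (carrier (tensor_product R M N)))"

end

theory Submission
  imports Defs
begin

text \<open>
  If an ideal \<open>I\<close> is isomorphic to \<open>I'\<close> with \<open>I' T = T\<close>, then \<open>I\<close> and \<open>I'\<close> have the same
  annihilator, so \<open>R\<close> has no zero-divisors, and neither has \<open>T\<close> because \<open>c T\<close> is contained in
  \<open>R\<close> for a regular \<open>c \<in> C\<close>. The same hypothesis makes finite families of elements of \<open>T\<close>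
  proportional to comaximal ones, so the intersection of two principal ideals of \<open>T\<close> is principal.

  An intersection of principal ideals of \<open>R\<close> is isomorphic to
  \<open>M = {m \<in> T. m z\<^sub>1, \<dots>, m z\<^sub>n \<in> R}\<close> with \<open>z\<^sub>1, \<dots>, z\<^sub>n \<in> R\<close> comaximal in \<open>T\<close>. As \<open>M\<close> contains \<open>1\<close>
  and \<open>C\<close>, only \<open>M / C\<close> has to be generated over \<open>A\<close>. Because \<open>A\<close> is a product of domains, the
  ideal of \<open>A\<close> generated by the \<open>z\<^sub>i\<close> contains a regular element \<open>a\<close>, which by flatness stays
  regular on \<open>B\<close>. Multiplication by \<open>a\<close> identifies \<open>M / C\<close> with the ideal
  \<open>{x \<in> A. x z\<^sub>1, \<dots>, x z\<^sub>n \<in> a A}\<close>, and after adding multiples of \<open>a\<close> to make the \<open>z\<^sub>i\<close> regular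
  this is a finite intersection of principal ideals up to a regular factor.
\<close>

section \<open>Ideals and non-zero-divisors\<close>

context cring
begin

lemma ideal_criterion:
  assumes "I \<subseteq> carrier R" "\<zero> \<in> I"
    and add: "\<And>x y. x \<in> I \<Longrightarrow> y \<in> I \<Longrightarrow> x \<oplus> y \<in> I"
    and mult: "\<And>r x. r \<in> carrier R \<Longrightarrow> x \<in> I \<Longrightarrow> r \<otimes> x \<in> I"
  shows "ideal I R"
proof (rule idealI)
  show "ring R" by (rule ring_axioms)
  show "subgroup I (add_monoid R)"
  proof (rule add.subgroupI)
    show "I \<subseteq> carrier R" "I \<noteq> {}" using assms(1,2) by auto
    fix a assume a: "a \<in> I"
    then have "(\<ominus> \<one>) \<otimes> a \<in> I" by (intro mult) auto
    then show "\<ominus> a \<in> I" using a assms(1) by (simp add: l_minus subset_iff)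
  qed (use add in auto)
  fix a x assume ax: "a \<in> I" "x \<in> carrier R"
  then show "x \<otimes> a \<in> I" by (rule mult[rotated])
  then show "a \<otimes> x \<in> I" using ax assms(1) by (simp add: m_comm subset_iff)
qed

lemma ideal_image_mult:
  assumes "ideal I R" "d \<in> carrier R"
  shows "ideal ((\<otimes>) d ` I) R"
proof -
  interpret I: ideal I R by fact
  show ?thesis
  proof (rule ideal_criterion)
    show "(\<otimes>) d ` I \<subseteq> carrier R" using assms(2) I.Icarr by auto
    show "\<zero> \<in> (\<otimes>) d ` I" using assms(2) I.zero_closed by (auto intro!: image_eqI[of _ _ \<zero>])
  next
    fix x y assume "x \<in> (\<otimes>) d ` I" "y \<in> (\<otimes>) d ` I"
    then obtain a b where ab: "a \<in> I" "b \<in> I" "x = d \<otimes> a" "y = d \<otimes> b" by auto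
    then have "x \<oplus> y = d \<otimes> (a \<oplus> b)" using assms(2) I.Icarr by (simp add: r_distr)
    then show "x \<oplus> y \<in> (\<otimes>) d ` I" using ab by auto
  next
    fix r x assume r: "r \<in> carrier R" and "x \<in> (\<otimes>) d ` I"
    then obtain a where a: "a \<in> I" "x = d \<otimes> a" by auto
    then have "r \<otimes> x = d \<otimes> (r \<otimes> a)" using assms(2) r I.Icarr by (simp add: m_lcomm)
    then show "r \<otimes> x \<in> (\<otimes>) d ` I" using a r I.I_l_closed by auto
  qed
qed

lemma non_zero_divisor_closed: "non_zero_divisor R d \<Longrightarrow> d \<in> carrier R"
  by (simp add: non_zero_divisor_def)

lemma non_zero_divisor_cancel:
  assumes "non_zero_divisor R d" "x \<in> carrier R" "y \<in> carrier R" "d \<otimes> x = d \<otimes> y"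
  shows "x = y"
proof -
  have d: "d \<in> carrier R" using assms(1) by (simp add: non_zero_divisor_def)
  have "(x \<ominus> y) \<otimes> d = d \<otimes> x \<ominus> d \<otimes> y" using d assms(2,3) by algebra
  also have "\<dots> = \<zero>" using d assms(2-4) by (simp add: r_right_minus_eq)
  finally have "x \<ominus> y = \<zero>" using assms(1-3) by (simp add: non_zero_divisor_def)
  then show ?thesis using assms(2,3) by (simp add: r_right_minus_eq)
qed

lemma non_zero_divisor_factor:
  assumes "non_zero_divisor R (a \<otimes> b)" "a \<in> carrier R" "b \<in> carrier R"
  shows "non_zero_divisor R a"
  unfolding non_zero_divisor_def
proof (intro conjI ballI impI)
  fix x assume x: "x \<in> carrier R" "x \<otimes> a = \<zero>"
  then have "x \<otimes> (a \<otimes> b) = \<zero>" using assms(2,3) by (simp flip: m_assoc)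
  then show "x = \<zero>" using assms(1) x by (simp add: non_zero_divisor_def)
qed fact

lemma non_zero_divisor_mult:
  assumes "non_zero_divisor R a" "non_zero_divisor R b"
  shows "non_zero_divisor R (a \<otimes> b)"
  using assms unfolding non_zero_divisor_def by (metis m_assoc m_closed)

text \<open>The product of all values serves as \<open>P\<close>, and the product of the other
  values as each cofactor. The cofactors turn divisibility conditions into intersections of
  principal ideals, and in the final proof they stand for the quotients of \<open>P\<close> by the
  given elements.\<close>

lemma common_multiple_with_cofactors:
  assumes "finite F" "\<And>x. x \<in> F \<Longrightarrow> non_zero_divisor R (f x)"
  shows "\<exists>P Q. non_zero_divisor R P \<and> (\<forall>x\<in>F. Q x \<in> carrier R \<and> Q x \<otimes> f x = P)"
  using assms
proof (induction F rule: finite_induct)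
  case empty
  show ?case by (rule exI[of _ \<one>]) (simp add: non_zero_divisor_def)
next
  case (insert y F)
  then obtain P Q where P: "non_zero_divisor R P"
    and Q: "\<And>x. x \<in> F \<Longrightarrow> Q x \<in> carrier R \<and> Q x \<otimes> f x = P"
    by auto
  have fy: "non_zero_divisor R (f y)" using insert.prems by auto
  have car: "P \<in> carrier R" "f y \<in> carrier R" "\<And>x. x \<in> F \<Longrightarrow> f x \<in> carrier R"
    using P insert.prems non_zero_divisor_closed by blast+
  let ?Q = "\<lambda>x. if x = y then P else f y \<otimes> Q x"
  have "?Q x \<in> carrier R \<and> ?Q x \<otimes> f x = P \<otimes> f y" if "x \<in> insert y F" for x
  proof (cases "x = y")
    case False
    then have x: "x \<in> F" using that by simp
    have "(f y \<otimes> Q x) \<otimes> f x = f y \<otimes> (Q x \<otimes> f x)"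
      using Q[OF x] car(2) car(3)[OF x] by (intro m_assoc) auto
    then show ?thesis using False Q[OF x] car(1,2) by (simp add: m_comm)
  qed (use car in simp)
  then show ?case using non_zero_divisor_mult[OF P fy]
    by (intro exI[of _ "P \<otimes> f y"] exI[of _ ?Q]) blast
qed

text \<open>Multiplication by \<open>d\<close> is linear and injective, so elements of
  \<open>I\<close> whose \<open>d\<close>-multiples generate \<open>d I\<close> already generate
  \<open>I\<close>.\<close>

lemma finitely_generated_cancel:
  assumes d: "non_zero_divisor R d" and I: "ideal I R"
    and fg: "finitely_generated_ideal ((\<otimes>) d ` I) R"
  shows "finitely_generated_ideal I R"
proof -
  interpret I: ideal I R by fact
  have dc: "d \<in> carrier R" using d by (simp add: non_zero_divisor_def)
  obtain F where F: "finite F" "F \<subseteq> carrier R" "(\<otimes>) d ` I = Idl F"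
    using fg by (auto simp: finitely_generated_ideal_def)
  have "F \<subseteq> (\<otimes>) d ` I" using F genideal_self by simp
  then obtain H where H: "H \<subseteq> I" "finite H" "F = (\<otimes>) d ` H"
    using F(1) by (meson finite_subset_image)
  have Hc: "H \<subseteq> carrier R" using H I.Icarr by auto
  have "I \<subseteq> Idl H"
  proof
    fix x assume x: "x \<in> I"
    \<comment> \<open>The \<open>d\<close>-multiples of \<open>Idl H\<close> form an ideal
      containing the generators of \<open>d I\<close>, hence containing \<open>d I\<close>.\<close>
    have "ideal ((\<otimes>) d ` (Idl H)) R" by (rule ideal_image_mult[OF genideal_ideal[OF Hc] dc])
    moreover have "F \<subseteq> (\<otimes>) d ` (Idl H)" using H(3) genideal_self[OF Hc] by auto
    ultimately have "(\<otimes>) d ` I \<subseteq> (\<otimes>) d ` (Idl H)" unfolding F(3) by (rule genideal_minimal)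
    then obtain y where y: "y \<in> Idl H" "d \<otimes> x = d \<otimes> y" using x by auto
    then have "x = y" using non_zero_divisor_cancel[OF d] x I.Icarr
        ideal.Icarr[OF genideal_ideal[OF Hc]] by auto
    then show "x \<in> Idl H" using y by simp
  qed
  then have "I = Idl H" using genideal_minimal[OF I H(1)] by auto
  then show ?thesis using H Hc by (auto simp: finitely_generated_ideal_def)
qed

lemma cgenideal_iff: "x \<in> PIdl a \<longleftrightarrow> (\<exists>r\<in>carrier R. x = r \<otimes> a)"
  by (auto simp: cgenideal_def)

text \<open>Let \<open>P = Q g \<otimes> g\<close> be a regular common multiple of \<open>G\<close>.
  Since \<open>Q g\<close> is regular, \<open>a\<close> divides \<open>x \<otimes> g\<close> exactly
  when \<open>a \<otimes> Q g\<close> divides \<open>x \<otimes> P\<close>. So \<open>P\<close>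
  times the colon ideal is an intersection of principal ideals, and \<open>P\<close> can be
  cancelled.\<close>

lemma finitely_generated_colon_regular:
  assumes qc: "quasi_coherent R" and a: "non_zero_divisor R a"
    and G: "finite G" "\<And>g. g \<in> G \<Longrightarrow> non_zero_divisor R g"
  shows "finitely_generated_ideal {x \<in> carrier R. \<forall>g\<in>G. x \<otimes> g \<in> PIdl a} R"
    (is "finitely_generated_ideal ?X R")
proof -
  obtain P Q where P: "non_zero_divisor R P"
    and Q: "\<And>g. g \<in> G \<Longrightarrow> Q g \<in> carrier R" "\<And>g. g \<in> G \<Longrightarrow> Q g \<otimes> g = P"
    using common_multiple_with_cofactors[of G "\<lambda>g. g"] G by metis
  have car: "a \<in> carrier R" "P \<in> carrier R" "\<And>g. g \<in> G \<Longrightarrow> g \<in> carrier R"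
    using a P G(2) non_zero_divisor_closed by blast+
  have X: "ideal ?X R"
  proof (rule ideal_criterion)
    interpret A: ideal "PIdl a" R by (rule cgenideal_ideal[OF car(1)])
    show "?X \<subseteq> carrier R" by auto
    show "\<zero> \<in> ?X" using car by auto
    show "x \<oplus> y \<in> ?X" if "x \<in> ?X" "y \<in> ?X" for x y
      using that car by (auto simp: l_distr)
    show "r \<otimes> x \<in> ?X" if "r \<in> carrier R" "x \<in> ?X" for r x
      using that car A.I_l_closed by (auto simp: m_assoc)
  qed
  \<comment> \<open>The ideal of \<open>P\<close> forces members of the intersection to be multiples
    of \<open>P\<close>, and keeps the index set non-empty when \<open>G\<close> is empty.\<close>
  let ?B = "insert P ((\<lambda>g. a \<otimes> Q g) ` G)"
  have "(\<otimes>) P ` ?X = (\<Inter>b\<in>?B. PIdl b)"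
  proof (intro equalityI subsetI)
    fix w assume "w \<in> (\<otimes>) P ` ?X"
    then obtain x where x: "x \<in> ?X" "w = P \<otimes> x" by auto
    have "w \<in> PIdl P" unfolding cgenideal_iff using x car m_comm by blast
    moreover have "w \<in> PIdl (a \<otimes> Q g)" if g: "g \<in> G" for g
    proof -
      obtain r where r: "r \<in> carrier R" "x \<otimes> g = r \<otimes> a" using x g by (auto simp: cgenideal_iff)
      have "w = Q g \<otimes> (x \<otimes> g)" using x(1) Q[OF g] car(3)[OF g] unfolding x(2) Q(2)[OF g, symmetric]
        by (simp add: m_ac)
      also have "\<dots> = r \<otimes> (a \<otimes> Q g)" using r Q[OF g] car by (simp add: m_ac)
      finally show ?thesis using r by (auto simp: cgenideal_iff)
    qed
    ultimately show "w \<in> (\<Inter>b\<in>?B. PIdl b)" by auto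
  next
    fix w assume w: "w \<in> (\<Inter>b\<in>?B. PIdl b)"
    then obtain x where x: "x \<in> carrier R" "w = x \<otimes> P" by (auto simp: cgenideal_iff)
    have "x \<otimes> g \<in> PIdl a" if g: "g \<in> G" for g
    proof -
      obtain r where r: "r \<in> carrier R" "w = r \<otimes> (a \<otimes> Q g)"
        using w g by (auto simp: cgenideal_iff)
      have "Q g \<otimes> (x \<otimes> g) = Q g \<otimes> (r \<otimes> a)"
        using r x Q[OF g] car car(3)[OF g] by (auto simp: m_ac)
      moreover have "non_zero_divisor R (Q g)"
        using non_zero_divisor_factor[of "Q g" g] P Q[OF g] car(3)[OF g] by simp
      ultimately have "x \<otimes> g = r \<otimes> a"
        using non_zero_divisor_cancel x r car car(3)[OF g] by auto
      then show ?thesis using r by (auto simp: cgenideal_iff)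
    qed
    then have "x \<in> ?X" using x(1) by simp
    moreover have "w = P \<otimes> x" using x car by (simp add: m_comm)
    ultimately show "w \<in> (\<otimes>) P ` ?X" by blast
  qed
  moreover have "finitely_generated_ideal (\<Inter>b\<in>?B. PIdl b) R"
    using qc G(1) car Q(1) unfolding quasi_coherent_def by (elim conjE allE[of _ ?B]) auto
  ultimately show ?thesis using finitely_generated_cancel[OF P X] by simp
qed

end

section \<open>Supporting idempotents\<close>

text \<open>The element \<open>e\<close> is idempotent, since \<open>\<one> \<ominus> e\<close> annihilates \<open>f\<close> and hence \<open>e\<close>.\<close>

definition supporting_idempotents :: "('a, 'b) ring_scheme \<Rightarrow> bool" where
  "supporting_idempotents S \<longleftrightarrow>
     (\<forall>f\<in>carrier S. \<exists>e\<in>carrier S. e \<otimes>\<^bsub>S\<^esub> f = f \<and>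
        (\<forall>x\<in>carrier S. x \<otimes>\<^bsub>S\<^esub> f = \<zero>\<^bsub>S\<^esub> \<longrightarrow> x \<otimes>\<^bsub>S\<^esub> e = \<zero>\<^bsub>S\<^esub>))"

context cring
begin

text \<open>The multiplier is \<open>s = \<one> \<ominus> e\<close> for the supporting idempotent
  \<open>e\<close> of \<open>f\<close>. As \<open>e\<close> fixes \<open>f\<close> and kills
  \<open>s\<close>, multiplying the sum by \<open>e\<close> recovers \<open>f\<close>. Whatever
  kills the sum therefore kills \<open>f\<close>, then \<open>e\<close>, and then
  \<open>g\<close>.\<close>

lemma merge_annihilators:
  assumes "supporting_idempotents R" "f \<in> carrier R" "g \<in> carrier R"
  obtains s where "s \<in> carrier R"
    "\<And>x. x \<in> carrier R \<Longrightarrow> x \<otimes> (f \<oplus> s \<otimes> g) = \<zero> \<Longrightarrow> x \<otimes> f = \<zero> \<and> x \<otimes> g = \<zero>"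
proof -
  obtain e where e: "e \<in> carrier R" "e \<otimes> f = f"
    and ann: "\<And>x. x \<in> carrier R \<Longrightarrow> x \<otimes> f = \<zero> \<Longrightarrow> x \<otimes> e = \<zero>"
    using assms(1,2) unfolding supporting_idempotents_def by blast
  have c: "\<one> \<ominus> e \<in> carrier R" using e by simp
  have "(\<one> \<ominus> e) \<otimes> f = f \<ominus> e \<otimes> f" using e(1) assms(2) by algebra
  then have "(\<one> \<ominus> e) \<otimes> f = \<zero>" using e(2) assms(2) by (simp add: r_right_minus_eq)
  then have ee: "(\<one> \<ominus> e) \<otimes> e = \<zero>" using ann c by blast
  show thesis
  proof (rule that[OF c], rule conjI)
    fix x assume x: "x \<in> carrier R" and 0: "x \<otimes> (f \<oplus> (\<one> \<ominus> e) \<otimes> g) = \<zero>"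
    have "x \<otimes> (e \<otimes> f) \<oplus> (x \<otimes> g) \<otimes> ((\<one> \<ominus> e) \<otimes> e) = (x \<otimes> (f \<oplus> (\<one> \<ominus> e) \<otimes> g)) \<otimes> e"
      using x e(1) assms by algebra
    then show xf: "x \<otimes> f = \<zero>" using e x assms(2,3) unfolding 0 ee by simp
    have xe: "x \<otimes> e = \<zero>" using ann[OF x xf] .
    have "x \<otimes> f \<oplus> x \<otimes> g = x \<otimes> (f \<oplus> (\<one> \<ominus> e) \<otimes> g) \<oplus> (x \<otimes> e) \<otimes> g" using x e(1) assms by algebra
    then show "x \<otimes> g = \<zero>" using x assms(3) unfolding 0 xf xe by simp
  qed
qed

text \<open>The generators are merged one at a time by \<open>merge_annihilators\<close>. If only
  zero annihilates all of \<open>G\<close>, the element found is regular; this is how the finite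
  product of domains enters the proof.\<close>

lemma ideal_element_with_same_annihilator:
  assumes si: "supporting_idempotents R" and "finite G" "G \<subseteq> carrier R"
  shows "\<exists>a\<in>Idl G. \<forall>x\<in>carrier R. x \<otimes> a = \<zero> \<longrightarrow> (\<forall>g\<in>G. x \<otimes> g = \<zero>)"
  using assms(2,3)
proof (induction G rule: finite_induct)
  case empty
  interpret I: ideal "Idl {}" R by (rule genideal_ideal) simp
  show ?case using I.zero_closed by blast
next
  case (insert g G)
  then obtain a where a: "a \<in> Idl G" "\<forall>x\<in>carrier R. x \<otimes> a = \<zero> \<longrightarrow> (\<forall>g\<in>G. x \<otimes> g = \<zero>)"
    by auto
  interpret I: ideal "Idl (insert g G)" R by (rule genideal_ideal[OF insert.prems])
  have "G \<subseteq> Idl (insert g G)" "g \<in> Idl (insert g G)" using genideal_self[OF insert.prems] by auto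
  then have mem: "a \<in> Idl (insert g G)" "g \<in> Idl (insert g G)"
    using a(1) genideal_minimal[OF I.ideal_axioms] by blast+
  have car: "a \<in> carrier R" "g \<in> carrier R" using mem I.Icarr by auto
  obtain s where s: "s \<in> carrier R"
    "\<And>x. x \<in> carrier R \<Longrightarrow> x \<otimes> (a \<oplus> s \<otimes> g) = \<zero> \<Longrightarrow> x \<otimes> a = \<zero> \<and> x \<otimes> g = \<zero>"
    using merge_annihilators[OF si car] by blast
  have "a \<oplus> s \<otimes> g \<in> Idl (insert g G)" using s(1) mem I.I_l_closed I.a_closed by blast
  moreover have "x \<otimes> h = \<zero>"
    if "x \<in> carrier R" "x \<otimes> (a \<oplus> s \<otimes> g) = \<zero>" "h \<in> insert g G" for x h
    using s(2)[OF that(1,2)] a(2) that(1,3) by blast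
  ultimately show ?case by blast
qed

text \<open>Adding a multiple of \<open>a\<close> to \<open>g\<close> does not change whether
  \<open>x \<otimes> g\<close> lies in \<open>PIdl a\<close>. The multiple can be chosen so that
  whatever kills \<open>g \<oplus> s \<otimes> a\<close> also kills the regular \<open>a\<close>,
  which makes every \<open>g\<close> regular and reduces to
  \<open>finitely_generated_colon_regular\<close>.\<close>

lemma finitely_generated_colon:
  assumes qc: "quasi_coherent R" and si: "supporting_idempotents R"
    and a: "non_zero_divisor R a" and G: "finite G" "G \<subseteq> carrier R"
  shows "finitely_generated_ideal {x \<in> carrier R. \<forall>g\<in>G. x \<otimes> g \<in> PIdl a} R"
proof -
  have ac: "a \<in> carrier R" using a by (simp add: non_zero_divisor_def)
  interpret A: ideal "PIdl a" R by (rule cgenideal_ideal[OF ac])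
  have "\<forall>g\<in>G. \<exists>s\<in>carrier R. non_zero_divisor R (g \<oplus> s \<otimes> a)"
  proof
    fix g assume "g \<in> G"
    then have g: "g \<in> carrier R" using G by auto
    obtain s where "s \<in> carrier R"
      "\<And>x. x \<in> carrier R \<Longrightarrow> x \<otimes> (g \<oplus> s \<otimes> a) = \<zero> \<Longrightarrow> x \<otimes> g = \<zero> \<and> x \<otimes> a = \<zero>"
      using merge_annihilators[OF si g ac] by blast
    then show "\<exists>s\<in>carrier R. non_zero_divisor R (g \<oplus> s \<otimes> a)"
      using a g ac unfolding non_zero_divisor_def by (metis a_closed m_closed)
  qed
  then obtain s where s: "\<And>g. g \<in> G \<Longrightarrow> s g \<in> carrier R"
      "\<And>g. g \<in> G \<Longrightarrow> non_zero_divisor R (g \<oplus> s g \<otimes> a)" by metis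
  have "x \<otimes> g \<in> PIdl a \<longleftrightarrow> x \<otimes> (g \<oplus> s g \<otimes> a) \<in> PIdl a" if "x \<in> carrier R" "g \<in> G" for x g
  proof -
    have g: "g \<in> carrier R" "s g \<in> carrier R" using that G s by auto
    have m: "(x \<otimes> s g) \<otimes> a \<in> PIdl a" "(\<ominus> (x \<otimes> s g)) \<otimes> a \<in> PIdl a"
      using that g A.I_l_closed cgenideal_self[OF ac] by auto
    have "x \<otimes> (g \<oplus> s g \<otimes> a) = x \<otimes> g \<oplus> (x \<otimes> s g) \<otimes> a"
      "x \<otimes> g = x \<otimes> (g \<oplus> s g \<otimes> a) \<oplus> (\<ominus> (x \<otimes> s g)) \<otimes> a"
      using that(1) g ac by algebra+
    then show ?thesis using m A.a_closed by metis
  qed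
  then have "{x \<in> carrier R. \<forall>g\<in>G. x \<otimes> g \<in> PIdl a} =
    {x \<in> carrier R. \<forall>g\<in>(\<lambda>g. g \<oplus> s g \<otimes> a) ` G. x \<otimes> g \<in> PIdl a}" by auto
  also have "finitely_generated_ideal \<dots> R"
    by (rule finitely_generated_colon_regular[OF qc a]) (use G s in auto)
  finally show ?thesis .
qed

end

section \<open>Products of integral domains\<close>

lemma supporting_idempotents_iso:
  assumes "ring A" "ring B" "A \<simeq> B" "supporting_idempotents B"
  shows "supporting_idempotents A"
proof -
  obtain h where h: "h \<in> ring_hom A B" "bij_betw h (carrier A) (carrier B)"
    using assms(3) by (auto simp: is_ring_iso_def ring_iso_def)
  interpret h: ring_hom_ring A B h by (rule ring_hom_ringI2[OF assms(1,2) h(1)])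
  have inj: "x = y" if "h x = h y" "x \<in> carrier A" "y \<in> carrier A" for x y
    using that h(2) by (auto simp: bij_betw_def inj_on_def)
  show ?thesis unfolding supporting_idempotents_def
  proof
    fix f assume f: "f \<in> carrier A"
    then obtain e' where e': "e' \<in> carrier B" "e' \<otimes>\<^bsub>B\<^esub> h f = h f"
      "\<And>x. x \<in> carrier B \<Longrightarrow> x \<otimes>\<^bsub>B\<^esub> h f = \<zero>\<^bsub>B\<^esub> \<Longrightarrow> x \<otimes>\<^bsub>B\<^esub> e' = \<zero>\<^bsub>B\<^esub>"
      using assms(4) unfolding supporting_idempotents_def by (meson h.hom_closed)
    obtain e where e: "e \<in> carrier A" "e' = h e" using e'(1) h(2) by (auto simp: bij_betw_def)
    have "e \<otimes>\<^bsub>A\<^esub> f = f" by (rule inj) (use e e' f in auto)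
    moreover have "x \<otimes>\<^bsub>A\<^esub> e = \<zero>\<^bsub>A\<^esub>" if "x \<in> carrier A" "x \<otimes>\<^bsub>A\<^esub> f = \<zero>\<^bsub>A\<^esub>" for x
      by (rule inj) (use e e'(3)[of "h x"] that f in \<open>auto simp flip: h.hom_mult\<close>)
    ultimately show "\<exists>e\<in>carrier A. e \<otimes>\<^bsub>A\<^esub> f = f \<and>
        (\<forall>x\<in>carrier A. x \<otimes>\<^bsub>A\<^esub> f = \<zero>\<^bsub>A\<^esub> \<longrightarrow> x \<otimes>\<^bsub>A\<^esub> e = \<zero>\<^bsub>A\<^esub>)" using e by auto
  qed
qed

lemma RDirProd_list_mult_Cons:
  "(a # as) \<otimes>\<^bsub>RDirProd_list (D # Ds)\<^esub> (b # bs) = (a \<otimes>\<^bsub>D\<^esub> b) # (as \<otimes>\<^bsub>RDirProd_list Ds\<^esub> bs)"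
  if "a \<in> carrier D" "b \<in> carrier D" "as \<in> carrier (RDirProd_list Ds)" "bs \<in> carrier (RDirProd_list Ds)"
  using ring_hom_memE(2)[OF RDirProd_list_hom1, of "(a, as)" D Ds "(b, bs)"] that
  by (simp add: RDirProd_carrier) (simp add: RDirProd_def DirProd_def monoid.defs)

text \<open>The idempotent is found coordinate by coordinate: in a domain take 0 for a zero entry
  and 1 for any other.\<close>

lemma supporting_idempotents_RDirProd_list:
  assumes "\<And>D. D \<in> set Ds \<Longrightarrow> domain D"
  shows "supporting_idempotents (RDirProd_list Ds)"
  using assms
proof (induction Ds)
  case Nil
  then show ?case by (auto simp: supporting_idempotents_def monoid.defs)
next
  case (Cons D Ds)
  interpret D: domain D using Cons.prems by simp
  have IH: "supporting_idempotents (RDirProd_list Ds)" using Cons by simp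
  show ?case unfolding supporting_idempotents_def
  proof
    fix f' assume "f' \<in> carrier (RDirProd_list (D # Ds))"
    then obtain f fs where f': "f' = f # fs" and f: "f \<in> carrier D" and fs: "fs \<in> carrier (RDirProd_list Ds)"
      by (auto simp: RDirProd_list_carrier)
    obtain es where es: "es \<in> carrier (RDirProd_list Ds)" "es \<otimes>\<^bsub>RDirProd_list Ds\<^esub> fs = fs"
      "\<forall>x\<in>carrier (RDirProd_list Ds). x \<otimes>\<^bsub>RDirProd_list Ds\<^esub> fs = \<zero>\<^bsub>RDirProd_list Ds\<^esub> \<longrightarrow>
          x \<otimes>\<^bsub>RDirProd_list Ds\<^esub> es = \<zero>\<^bsub>RDirProd_list Ds\<^esub>"
      using IH fs unfolding supporting_idempotents_def by blast
    define e where "e = (if f = \<zero>\<^bsub>D\<^esub> then \<zero>\<^bsub>D\<^esub> else \<one>\<^bsub>D\<^esub>)"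
    have e: "e \<in> carrier D" "e \<otimes>\<^bsub>D\<^esub> f = f"
      "\<And>x. x \<in> carrier D \<Longrightarrow> x \<otimes>\<^bsub>D\<^esub> f = \<zero>\<^bsub>D\<^esub> \<Longrightarrow> x \<otimes>\<^bsub>D\<^esub> e = \<zero>\<^bsub>D\<^esub>"
      using f D.integral by (auto simp: e_def)
    show "\<exists>e\<in>carrier (RDirProd_list (D # Ds)). e \<otimes>\<^bsub>RDirProd_list (D # Ds)\<^esub> f' = f' \<and>
        (\<forall>x\<in>carrier (RDirProd_list (D # Ds)). x \<otimes>\<^bsub>RDirProd_list (D # Ds)\<^esub> f' = \<zero>\<^bsub>RDirProd_list (D # Ds)\<^esub> \<longrightarrow>
          x \<otimes>\<^bsub>RDirProd_list (D # Ds)\<^esub> e = \<zero>\<^bsub>RDirProd_list (D # Ds)\<^esub>)"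
      unfolding f'
      by (rule bexI[of _ "e # es"])
        (use e es f fs in \<open>auto simp: RDirProd_list_carrier RDirProd_list_mult_Cons RDirProd_list_zero'\<close>)
  qed
qed

section \<open>Flatness of an overring\<close>

lemma generate_free_Abelian_group_subset:
  assumes "Z \<subseteq> carrier (free_Abelian_group S)" "Z \<subseteq> K" "0 \<in> K"
    "\<And>x y. x \<in> K \<Longrightarrow> y \<in> K \<Longrightarrow> x + y \<in> K" "\<And>x. x \<in> K \<Longrightarrow> - x \<in> K"
  shows "generate (free_Abelian_group S) Z \<subseteq> K"
proof
  fix x assume "x \<in> generate (free_Abelian_group S) Z"
  then show "x \<in> K"
  proof (induction rule: generate.induct)
    case (inv h)
    \<comment> \<open>Group inverse and negation are identified on the carrier, so membership comes
      first.\<close>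
    then have "h \<in> carrier (free_Abelian_group S)" using assms(1) by blast
    then have "inv\<^bsub>free_Abelian_group S\<^esub> h = - h" by simp
    then show ?case using assms inv by auto
  qed (use assms in auto)
qed

lemma tensor_relations_carrier:
  assumes "module R M" "module R N"
  shows "tensor_relations R M N \<subseteq> carrier (free_Abelian_group (carrier M \<times> carrier N))"
proof -
  interpret M: module R M by fact
  interpret N: module R N by fact
  interpret F: group "free_Abelian_group (carrier M \<times> carrier N)" by simp
  have diff: "x - y \<in> carrier (free_Abelian_group S)"
    if "x \<in> carrier (free_Abelian_group S)" "y \<in> carrier (free_Abelian_group S)" for x y and S :: "('m \<times> 'n) set"
    using that keys_diff[of x y] by auto
  show ?thesis unfolding tensor_relations_def
    by (auto simp del: carrier_free_Abelian_group_iff intro!: diff)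
qed

lemma subgroup_tensor_subgroup:
  assumes "module R M" "module R N"
  shows "subgroup (tensor_subgroup R M N) (free_Abelian_group (carrier M \<times> carrier N))"
  unfolding tensor_subgroup_def
  by (rule group.generate_is_subgroup[OF _ tensor_relations_carrier[OF assms]]) simp

lemma tensor_subgroup_closed:
  assumes "module R M" "module R N"
  shows "0 \<in> tensor_subgroup R M N"
    and "x \<in> tensor_subgroup R M N \<Longrightarrow> y \<in> tensor_subgroup R M N \<Longrightarrow> x + y \<in> tensor_subgroup R M N"
    and "x \<in> tensor_subgroup R M N \<Longrightarrow> - x \<in> tensor_subgroup R M N"
proof -
  interpret S: subgroup "tensor_subgroup R M N" "free_Abelian_group (carrier M \<times> carrier N)"
    by (rule subgroup_tensor_subgroup[OF assms])
  show "0 \<in> tensor_subgroup R M N" using S.one_closed by simp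
  show "x \<in> tensor_subgroup R M N \<Longrightarrow> y \<in> tensor_subgroup R M N \<Longrightarrow> x + y \<in> tensor_subgroup R M N"
    using S.m_closed by fastforce
  show "x \<in> tensor_subgroup R M N \<Longrightarrow> - x \<in> tensor_subgroup R M N"
    using S.m_inv_closed[of x] S.mem_carrier[of x] by (metis carrier_free_Abelian_group_iff inv_free_Abelian_group)
qed

text \<open>This is the universal property of the tensor product, stated before passing to the
  quotient. The free abelian group supplies \<open>h\<close>, and the kernel of \<open>h\<close>
  contains the bilinearity relations, hence the subgroup they generate. It serves to test by an
  explicit balanced map what a vanishing tensor implies.\<close>

lemma balanced_map_extends:
  assumes M: "module R M" and N: "module R N" and G: "comm_group G"
    and closed: "\<And>x y. x \<in> carrier M \<Longrightarrow> y \<in> carrier N \<Longrightarrow> b x y \<in> carrier G"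
    and add_left: "\<And>x x' y. x \<in> carrier M \<Longrightarrow> x' \<in> carrier M \<Longrightarrow> y \<in> carrier N \<Longrightarrow>
        b (x \<oplus>\<^bsub>M\<^esub> x') y = b x y \<otimes>\<^bsub>G\<^esub> b x' y"
    and add_right: "\<And>x y y'. x \<in> carrier M \<Longrightarrow> y \<in> carrier N \<Longrightarrow> y' \<in> carrier N \<Longrightarrow>
        b x (y \<oplus>\<^bsub>N\<^esub> y') = b x y \<otimes>\<^bsub>G\<^esub> b x y'"
    and balanced: "\<And>r x y. r \<in> carrier R \<Longrightarrow> x \<in> carrier M \<Longrightarrow> y \<in> carrier N \<Longrightarrow>
        b (r \<odot>\<^bsub>M\<^esub> x) y = b x (r \<odot>\<^bsub>N\<^esub> y)"
  shows "\<exists>h\<in>hom (free_Abelian_group (carrier M \<times> carrier N)) G.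
    (\<forall>x\<in>carrier M. \<forall>y\<in>carrier N. h (frag_of (x, y)) = b x y) \<and>
    (\<forall>u\<in>tensor_subgroup R M N. h u = \<one>\<^bsub>G\<^esub>)"
proof -
  interpret M: module R M by (rule M)
  interpret N: module R N by (rule N)
  interpret G: comm_group G by (rule G)
  let ?F = "free_Abelian_group (carrier M \<times> carrier N)"
  have im: "(\<lambda>(x, y). b x y) ` (carrier M \<times> carrier N) \<subseteq> carrier G" using closed by auto
  obtain h where h: "h \<in> hom ?F G"
    "\<And>z. z \<in> carrier M \<times> carrier N \<Longrightarrow> h (frag_of z) = (\<lambda>(x, y). b x y) z"
    using G.free_Abelian_group_universal[OF im] by blast
  interpret h: group_hom ?F G h
    by (rule group_hom.intro) (simp_all add: group_hom_axioms_def h(1) G.is_group)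
  have hb: "h (frag_of (x, y)) = b x y" if "x \<in> carrier M" "y \<in> carrier N" for x y
    using h(2)[of "(x, y)"] that by simp
  have h_add: "h (u + v) = h u \<otimes>\<^bsub>G\<^esub> h v" if "u \<in> carrier ?F" "v \<in> carrier ?F" for u v
    using h.hom_mult[OF that] by simp
  have diff: "x - y \<in> carrier ?F" if "x \<in> carrier ?F" "y \<in> carrier ?F" for x y
    using that keys_diff[of x y] by auto
  \<comment> \<open>Each relation is regrouped as a difference of two elements on which
    \<open>h\<close> agrees.\<close>
  have zero: "h (u - v) = \<one>\<^bsub>G\<^esub>" if "h u = h v" "u \<in> carrier ?F" "v \<in> carrier ?F" for u v
  proof -
    have "h u = h (u - v) \<otimes>\<^bsub>G\<^esub> h v" using h_add[OF diff[OF that(2,3)] that(3)] by simp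
    then show ?thesis using that(1) h.hom_closed[OF that(3)] h.hom_closed[OF diff[OF that(2,3)]]
      by (metis G.r_cancel_one')
  qed
  have "tensor_relations R M N \<subseteq> kernel ?F G h"
  proof
    fix u assume u: "u \<in> tensor_relations R M N"
    then have "u \<in> carrier ?F" using tensor_relations_carrier[OF M N] by blast
    moreover have "h u = \<one>\<^bsub>G\<^esub>"
      using u unfolding tensor_relations_def
    proof (elim UnE CollectE exE conjE)
      fix x x' y assume *: "u = frag_of (x \<oplus>\<^bsub>M\<^esub> x', y) - frag_of (x, y) - frag_of (x', y)"
        "x \<in> carrier M" "x' \<in> carrier M" "y \<in> carrier N"
      have "h (frag_of (x \<oplus>\<^bsub>M\<^esub> x', y) - (frag_of (x, y) + frag_of (x', y))) = \<one>\<^bsub>G\<^esub>"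
      proof (rule zero)
        have "frag_of (x, y) + frag_of (x', y) = frag_of (x, y) \<otimes>\<^bsub>?F\<^esub> frag_of (x', y)" by simp
        also have "\<dots> \<in> carrier ?F" using * by (intro h.G.m_closed) auto
        finally show "frag_of (x, y) + frag_of (x', y) \<in> carrier ?F" .
      qed (use * in \<open>auto simp: hb h_add add_left simp del: carrier_free_Abelian_group_iff\<close>)
      then show "h u = \<one>\<^bsub>G\<^esub>" using *(1) by (simp add: diff_diff_eq)
    next
      fix x y y' assume *: "u = frag_of (x, y \<oplus>\<^bsub>N\<^esub> y') - frag_of (x, y) - frag_of (x, y')"
        "x \<in> carrier M" "y \<in> carrier N" "y' \<in> carrier N"
      have "h (frag_of (x, y \<oplus>\<^bsub>N\<^esub> y') - (frag_of (x, y) + frag_of (x, y'))) = \<one>\<^bsub>G\<^esub>"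
      proof (rule zero)
        have "frag_of (x, y) + frag_of (x, y') = frag_of (x, y) \<otimes>\<^bsub>?F\<^esub> frag_of (x, y')" by simp
        also have "\<dots> \<in> carrier ?F" using * by (intro h.G.m_closed) auto
        finally show "frag_of (x, y) + frag_of (x, y') \<in> carrier ?F" .
      qed (use * in \<open>auto simp: hb h_add add_right simp del: carrier_free_Abelian_group_iff\<close>)
      then show "h u = \<one>\<^bsub>G\<^esub>" using *(1) by (simp add: diff_diff_eq)
    next
      fix r x y assume *: "u = frag_of (r \<odot>\<^bsub>M\<^esub> x, y) - frag_of (x, r \<odot>\<^bsub>N\<^esub> y)"
        "r \<in> carrier R" "x \<in> carrier M" "y \<in> carrier N"
      show "h u = \<one>\<^bsub>G\<^esub>" unfolding *(1)
        by (rule zero) (use * in \<open>auto simp: hb balanced simp del: carrier_free_Abelian_group_iff\<close>)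
    qed
    ultimately show "u \<in> kernel ?F G h" by (simp add: kernel_def)
  qed
  then have "tensor_subgroup R M N \<subseteq> kernel ?F G h"
    unfolding tensor_subgroup_def by (rule h.G.generate_subgroup_incl[OF _ h.subgroup_kernel])
  then have "\<forall>u\<in>tensor_subgroup R M N. h u = \<one>\<^bsub>G\<^esub>" by (auto simp: kernel_def)
  then show ?thesis using h(1) hb by blast
qed

text \<open>A tensor over \<open>N\<close> that vanishes over the larger module \<open>N'\<close>
  vanishes already over \<open>N\<close>, by flatness applied to the inclusion. In terms of cosets,
  \<open>u\<close> and 0 have the same image, namely the whole relation subgroup of
  \<open>N'\<close>.\<close>

lemma flat_module_submodule:
  fixes M :: "('a, 'm) module" and N N' :: "('a, (nat \<Rightarrow> 'a) set) module"
  assumes flat: "flat_module R M" and N: "module R N" and N': "module R N'"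
    and sub: "carrier N \<subseteq> carrier N'" "add N = add N'" "smult N = smult N'"
    and u: "Poly_Mapping.keys u \<subseteq> carrier M \<times> carrier N" "u \<in> tensor_subgroup R M N'"
  shows "u \<in> tensor_subgroup R M N"
proof -
  have M: "module R M" using flat by (simp add: flat_module_def)
  let ?F = "free_Abelian_group (carrier M \<times> carrier N)"
  let ?S = "tensor_subgroup R M N" and ?S' = "tensor_subgroup R M N'"
  interpret F: comm_group ?F by (rule abelian_free_Abelian_group)
  have "(\<lambda>x. x) \<in> module_hom R N N'" using sub by (auto simp: module_hom_def)
  then have inj: "inj_on (tensor_map R M N' (\<lambda>x. x)) (carrier (tensor_product R M N))"
    using flat N N' unfolding flat_module_def
    by (elim conjE allE[of _ N] allE[of _ N'] allE[of _ "\<lambda>x. x"]) (auto simp: inj_on_def)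
  have "?S \<subseteq> ?S'"
    unfolding tensor_subgroup_def[of R M N]
  proof (rule generate_free_Abelian_group_subset)
    show "tensor_relations R M N \<subseteq> carrier ?F" by (rule tensor_relations_carrier[OF M N])
    have "tensor_relations R M N \<subseteq> tensor_relations R M N'"
      unfolding tensor_relations_def sub(2,3) using subsetD[OF sub(1)]
      by (intro Un_mono; blast)
    also have "\<dots> \<subseteq> ?S'" by (auto simp: tensor_subgroup_def intro: generate.incl)
    finally show "tensor_relations R M N \<subseteq> ?S'" .
  qed (use tensor_subgroup_closed[OF M N'] in auto)
  note S' = this tensor_subgroup_closed[OF M N']
  interpret S: subgroup ?S ?F by (rule subgroup_tensor_subgroup[OF M N])
  \<comment> \<open>The inclusion is the identity on elements, so the induced map of free abelian
    groups is the identity too.\<close>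
  have ext: "frag_extend (\<lambda>(x, y). frag_of (x, y)) = (\<lambda>v :: 'm \<times> (nat \<Rightarrow> 'a) set \<Rightarrow>\<^sub>0 int. v)"
  proof -
    have "(\<lambda>(x, y). frag_of (x, y)) = (frag_of :: 'm \<times> (nat \<Rightarrow> 'a) set \<Rightarrow> _)" by auto
    then show ?thesis using frag_expansion by metis
  qed
  \<comment> \<open>Because \<open>?S \<subseteq> ?S'\<close>, adding \<open>?S'\<close> to the
    coset of any \<open>v \<in> ?S'\<close> gives back \<open>?S'\<close>.\<close>
  have image: "tensor_map R M N' (\<lambda>x. x) (?S #>\<^bsub>?F\<^esub> v) = ?S'" if "v \<in> ?S'" for v
  proof -
    have "tensor_map R M N' (\<lambda>x. x) (?S #>\<^bsub>?F\<^esub> v) = (\<Union>a\<in>?S'. \<Union>s\<in>?S. {a + (s + v)})"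
      unfolding tensor_map_def ext by (auto simp: set_mult_def r_coset_def)
    also have "\<dots> = ?S'"
    proof (intro equalityI subsetI)
      fix w assume w: "w \<in> ?S'"
      have "w = (w + - v) + (0 + v)" "w + - v \<in> ?S'" using S'(3)[OF w S'(4)[OF that]] by auto
      then show "w \<in> (\<Union>a\<in>?S'. \<Union>s\<in>?S. {a + (s + v)})"
        using tensor_subgroup_closed(1)[OF M N] by blast
    qed (use S' that in auto)
    finally show ?thesis .
  qed
  have "u \<in> carrier ?F" using u by simp
  then have "?S #>\<^bsub>?F\<^esub> u \<in> carrier (tensor_product R M N)" "?S #>\<^bsub>?F\<^esub> 0 \<in> carrier (tensor_product R M N)"
    using F.rcosetsI[OF S.subset] by (auto simp: tensor_product_def FactGroup_def)
  moreover have "tensor_map R M N' (\<lambda>x. x) (?S #>\<^bsub>?F\<^esub> u) = tensor_map R M N' (\<lambda>x. x) (?S #>\<^bsub>?F\<^esub> 0)"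
    using image u(2) S'(2) by simp
  ultimately have "?S #>\<^bsub>?F\<^esub> u = ?S #>\<^bsub>?F\<^esub> 0" using inj by (auto simp: inj_on_def)
  moreover have "u \<in> ?S #>\<^bsub>?F\<^esub> u" using F.rcos_self[OF \<open>u \<in> carrier ?F\<close> S.subgroup_axioms] .
  ultimately show ?thesis by (auto simp: r_coset_def)
qed

text \<open>Flatness is only tested on modules with elements in \<^typ>\<open>(nat \<Rightarrow> 'a) set\<close>.\<close>

definition copy_of :: "'a \<Rightarrow> (nat \<Rightarrow> 'a) set" where
  "copy_of x = {\<lambda>_. x}"

definition copy_inv :: "(nat \<Rightarrow> 'a) set \<Rightarrow> 'a" where
  "copy_inv Z = the_elem Z 0"

lemma copy_inv_copy_of [simp]: "copy_inv (copy_of x) = x"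
  by (simp add: copy_inv_def copy_of_def)

definition copy_module :: "'a ring \<Rightarrow> 'a set \<Rightarrow> ('a, (nat \<Rightarrow> 'a) set) module" where
  "copy_module S U =
     \<lparr>carrier = copy_of ` U,
      monoid.mult = (\<lambda>Z Y. copy_of (copy_inv Z \<otimes>\<^bsub>S\<^esub> copy_inv Y)),
      one = copy_of \<one>\<^bsub>S\<^esub>, ring.zero = copy_of \<zero>\<^bsub>S\<^esub>,
      add = (\<lambda>Z Y. copy_of (copy_inv Z \<oplus>\<^bsub>S\<^esub> copy_inv Y)),
      smult = (\<lambda>r Z. copy_of (r \<otimes>\<^bsub>S\<^esub> copy_inv Z))\<rparr>"

lemma copy_module_simps [simp]:
  "carrier (copy_module S U) = copy_of ` U"
  "\<zero>\<^bsub>copy_module S U\<^esub> = copy_of \<zero>\<^bsub>S\<^esub>"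
  "Z \<oplus>\<^bsub>copy_module S U\<^esub> Y = copy_of (copy_inv Z \<oplus>\<^bsub>S\<^esub> copy_inv Y)"
  "r \<odot>\<^bsub>copy_module S U\<^esub> Z = copy_of (r \<otimes>\<^bsub>S\<^esub> copy_inv Z)"
  by (simp_all add: copy_module_def)

lemma module_copy_module:
  assumes "cring S" "ideal U S"
  shows "module S (copy_module S U)"
proof -
  interpret S: cring S by fact
  interpret U: ideal U S by fact
  show ?thesis
  proof (rule moduleI[OF assms(1)])
    show "abelian_group (copy_module S U)"
    proof (rule abelian_groupI)
      fix Z assume "Z \<in> carrier (copy_module S U)"
      then obtain x where x: "x \<in> U" "Z = copy_of x" by auto
      then show "\<exists>y\<in>carrier (copy_module S U). y \<oplus>\<^bsub>copy_module S U\<^esub> Z = \<zero>\<^bsub>copy_module S U\<^esub>"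
        using U.Icarr by (intro bexI[of _ "copy_of (\<ominus>\<^bsub>S\<^esub> x)"]) (auto simp: S.l_neg U.a_inv_closed)
    qed (use U.Icarr in \<open>auto simp: S.a_ac\<close>)
  qed (use U.Icarr U.I_l_closed in \<open>auto simp: S.l_distr S.r_distr S.m_assoc\<close>)
qed

text \<open>The conductor is left out: denominators and comaximal families depend only on the pair
  of rings. Every conductor square is later made an instance.\<close>

locale ring_extension = T?: cring T for R T :: "'a ring" +
  assumes subring: "subring (carrier R) T"
    and operations: "R = T\<lparr>carrier := carrier R\<rparr>"
begin

lemma R_ops [simp]: "(\<otimes>\<^bsub>R\<^esub>) = (\<otimes>\<^bsub>T\<^esub>)" "(\<oplus>\<^bsub>R\<^esub>) = (\<oplus>\<^bsub>T\<^esub>)" "\<zero>\<^bsub>R\<^esub> = \<zero>\<^bsub>T\<^esub>" "\<one>\<^bsub>R\<^esub> = \<one>\<^bsub>T\<^esub>"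
proof -
  have "(\<otimes>\<^bsub>R\<^esub>) = (\<otimes>\<^bsub>T\<lparr>carrier := carrier R\<rparr>\<^esub>)" "(\<oplus>\<^bsub>R\<^esub>) = (\<oplus>\<^bsub>T\<lparr>carrier := carrier R\<rparr>\<^esub>)"
    "\<zero>\<^bsub>R\<^esub> = \<zero>\<^bsub>T\<lparr>carrier := carrier R\<rparr>\<^esub>" "\<one>\<^bsub>R\<^esub> = \<one>\<^bsub>T\<lparr>carrier := carrier R\<rparr>\<^esub>"
    by (rule arg_cong[OF operations])+
  then show "(\<otimes>\<^bsub>R\<^esub>) = (\<otimes>\<^bsub>T\<^esub>)" "(\<oplus>\<^bsub>R\<^esub>) = (\<oplus>\<^bsub>T\<^esub>)" "\<zero>\<^bsub>R\<^esub> = \<zero>\<^bsub>T\<^esub>" "\<one>\<^bsub>R\<^esub> = \<one>\<^bsub>T\<^esub>" by simp_all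
qed

lemma R_subset: "x \<in> carrier R \<Longrightarrow> x \<in> carrier T"
  using subringE(1)[OF subring] by auto

lemma cring_R: "cring R"
proof -
  have "cring (T\<lparr>carrier := carrier R\<rparr>)"
    using subcring_iff[OF subringE(1)[OF subring]] subcringI'[OF subring] by simp
  then show ?thesis by (simp flip: operations)
qed

sublocale R: cring R by (rule cring_R)

lemma R_closed [simp]:
  "\<zero>\<^bsub>T\<^esub> \<in> carrier R" "\<one>\<^bsub>T\<^esub> \<in> carrier R"
  "x \<in> carrier R \<Longrightarrow> y \<in> carrier R \<Longrightarrow> x \<otimes>\<^bsub>T\<^esub> y \<in> carrier R"
  "x \<in> carrier R \<Longrightarrow> y \<in> carrier R \<Longrightarrow> x \<oplus>\<^bsub>T\<^esub> y \<in> carrier R"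
  "x \<in> carrier R \<Longrightarrow> \<ominus>\<^bsub>T\<^esub> x \<in> carrier R"
  using subringE[OF subring] by auto

lemma R_closed_minus [simp]:
  "x \<in> carrier R \<Longrightarrow> y \<in> carrier R \<Longrightarrow> x \<ominus>\<^bsub>T\<^esub> y \<in> carrier R"
  by (simp add: a_minus_def)

text \<open>
  The tensor \<open>t \<otimes> c - 1 \<otimes> u\<close> vanishes over \<open>R\<close>, hence by flatness over the ideal \<open>N = cR + uR\<close>.
  With \<open>K\<close> the ideal of \<open>T\<close> generated by the denominators of \<open>t\<close>, the balanced map
  \<open>(s, c x + u y) \<mapsto> s y + K\<close> on \<open>T \<times> N\<close> therefore sends \<open>(1, u)\<close> to zero.
\<close>

lemma flat_denominator_ideal:
  assumes flat: "flat_module R (mult_module T (carrier T))"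
    and t: "t \<in> carrier T" and c: "non_zero_divisor T c" "c \<in> carrier R"
    and u: "c \<otimes>\<^bsub>T\<^esub> t \<in> carrier R"
  shows "Idl\<^bsub>T\<^esub> {r \<in> carrier R. r \<otimes>\<^bsub>T\<^esub> t \<in> carrier R} = carrier T"
    (is "Idl\<^bsub>T\<^esub> ?J = _")
proof -
  define u where "u = c \<otimes>\<^bsub>T\<^esub> t"
  have uR: "u \<in> carrier R" using assms by (simp add: u_def)
  have cT: "c \<in> carrier T" using c(2) R_subset by simp
  have JT: "?J \<subseteq> carrier T" using R_subset by auto
  define K where "K = Idl\<^bsub>T\<^esub> ?J"
  have idK: "ideal K T" unfolding K_def by (rule T.genideal_ideal[OF JT])
  interpret K: ideal K T by (rule idK)
  have JK: "?J \<subseteq> K" unfolding K_def by (rule T.genideal_self[OF JT])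
  define U where "U = {c \<otimes>\<^bsub>T\<^esub> x \<oplus>\<^bsub>T\<^esub> u \<otimes>\<^bsub>T\<^esub> y | x y. x \<in> carrier R \<and> y \<in> carrier R}"
  have U_I: "c \<otimes>\<^bsub>T\<^esub> x \<oplus>\<^bsub>T\<^esub> u \<otimes>\<^bsub>T\<^esub> y \<in> U" if "x \<in> carrier R" "y \<in> carrier R" for x y
    using that by (auto simp: U_def)
  have U_add: "(c \<otimes>\<^bsub>T\<^esub> x \<oplus>\<^bsub>T\<^esub> u \<otimes>\<^bsub>T\<^esub> y) \<oplus>\<^bsub>T\<^esub> (c \<otimes>\<^bsub>T\<^esub> x' \<oplus>\<^bsub>T\<^esub> u \<otimes>\<^bsub>T\<^esub> y') =
      c \<otimes>\<^bsub>T\<^esub> (x \<oplus>\<^bsub>T\<^esub> x') \<oplus>\<^bsub>T\<^esub> u \<otimes>\<^bsub>T\<^esub> (y \<oplus>\<^bsub>T\<^esub> y')"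
    if "x \<in> carrier R" "y \<in> carrier R" "x' \<in> carrier R" "y' \<in> carrier R" for x y x' y'
    using that[THEN R_subset] cT R_subset[OF uR] by algebra
  have U_mult: "r \<otimes>\<^bsub>T\<^esub> (c \<otimes>\<^bsub>T\<^esub> x \<oplus>\<^bsub>T\<^esub> u \<otimes>\<^bsub>T\<^esub> y) = c \<otimes>\<^bsub>T\<^esub> (r \<otimes>\<^bsub>T\<^esub> x) \<oplus>\<^bsub>T\<^esub> u \<otimes>\<^bsub>T\<^esub> (r \<otimes>\<^bsub>T\<^esub> y)"
    if "x \<in> carrier R" "y \<in> carrier R" "r \<in> carrier R" for x y r
    using that[THEN R_subset] cT R_subset[OF uR] by algebra
  have zeroU: "\<zero>\<^bsub>T\<^esub> \<in> U" using U_I[of "\<zero>\<^bsub>T\<^esub>" "\<zero>\<^bsub>T\<^esub>"] cT R_subset[OF uR] by simp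
  have U: "ideal U R"
  proof (rule R.ideal_criterion)
    show "U \<subseteq> carrier R" using c uR by (auto simp: U_def)
    show "\<zero>\<^bsub>R\<^esub> \<in> U" using zeroU by simp
    show "a \<oplus>\<^bsub>R\<^esub> b \<in> U" if ab: "a \<in> U" "b \<in> U" for a b
    proof -
      obtain x y x' y' where *: "x \<in> carrier R" "y \<in> carrier R" "x' \<in> carrier R" "y' \<in> carrier R"
        "a = c \<otimes>\<^bsub>T\<^esub> x \<oplus>\<^bsub>T\<^esub> u \<otimes>\<^bsub>T\<^esub> y" "b = c \<otimes>\<^bsub>T\<^esub> x' \<oplus>\<^bsub>T\<^esub> u \<otimes>\<^bsub>T\<^esub> y'"
        using ab unfolding U_def by blast
      show ?thesis using U_add[OF *(1-4)] U_I *(1-4) unfolding *(5,6) by simp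
    qed
    show "r \<otimes>\<^bsub>R\<^esub> a \<in> U" if ra: "r \<in> carrier R" "a \<in> U" for r a
    proof -
      obtain x y where *: "x \<in> carrier R" "y \<in> carrier R" "a = c \<otimes>\<^bsub>T\<^esub> x \<oplus>\<^bsub>T\<^esub> u \<otimes>\<^bsub>T\<^esub> y"
        using ra unfolding U_def by blast
      show ?thesis using U_mult[OF *(1,2) ra(1)] U_I *(1,2) ra(1) unfolding *(3) by simp
    qed
  qed
  have UR: "U \<subseteq> carrier R" using c uR by (auto simp: U_def)
  \<comment> \<open>An element of \<open>U\<close> may have several representations, so a
    coefficient of \<open>u\<close> is chosen; \<open>coset\<close> below makes the choice
    irrelevant modulo \<open>K\<close>.\<close>
  define y_of where "y_of n = (SOME y. y \<in> carrier R \<and> (\<exists>x\<in>carrier R. n = c \<otimes>\<^bsub>T\<^esub> x \<oplus>\<^bsub>T\<^esub> u \<otimes>\<^bsub>T\<^esub> y))" for n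
  have y_of: "y_of n \<in> carrier R \<and> (\<exists>x\<in>carrier R. n = c \<otimes>\<^bsub>T\<^esub> x \<oplus>\<^bsub>T\<^esub> u \<otimes>\<^bsub>T\<^esub> y_of n)" if "n \<in> U" for n
    unfolding y_of_def by (rule someI_ex) (use that in \<open>auto simp: U_def\<close>)
  define b where "b s Z = K +>\<^bsub>T\<^esub> (s \<otimes>\<^bsub>T\<^esub> y_of (copy_inv Z))" for s Z
  \<comment> \<open>With \<open>u = c t\<close>, comparing two representations and cancelling
    \<open>c\<close> gives \<open>(y' - y) t = x - x'\<close>. Thus \<open>y' - y\<close> is a
    denominator of \<open>t\<close> and lies in \<open>K\<close>.\<close>
  have coset: "K +>\<^bsub>T\<^esub> (s \<otimes>\<^bsub>T\<^esub> y') = K +>\<^bsub>T\<^esub> (s \<otimes>\<^bsub>T\<^esub> y)"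
    if s: "s \<in> carrier T" and x: "x \<in> carrier R" "y \<in> carrier R" "x' \<in> carrier R" "y' \<in> carrier R"
      and eq: "c \<otimes>\<^bsub>T\<^esub> x' \<oplus>\<^bsub>T\<^esub> u \<otimes>\<^bsub>T\<^esub> y' = c \<otimes>\<^bsub>T\<^esub> x \<oplus>\<^bsub>T\<^esub> u \<otimes>\<^bsub>T\<^esub> y" for s x y x' y'
  proof -
    have xT: "x \<in> carrier T" "y \<in> carrier T" "x' \<in> carrier T" "y' \<in> carrier T" using x R_subset by auto
    have "c \<otimes>\<^bsub>T\<^esub> ((y' \<ominus>\<^bsub>T\<^esub> y) \<otimes>\<^bsub>T\<^esub> t) =
        (c \<otimes>\<^bsub>T\<^esub> x' \<oplus>\<^bsub>T\<^esub> (c \<otimes>\<^bsub>T\<^esub> t) \<otimes>\<^bsub>T\<^esub> y') \<ominus>\<^bsub>T\<^esub> c \<otimes>\<^bsub>T\<^esub> x' \<ominus>\<^bsub>T\<^esub> (c \<otimes>\<^bsub>T\<^esub> t) \<otimes>\<^bsub>T\<^esub> y"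
      using xT cT t by algebra
    also have "\<dots> = (c \<otimes>\<^bsub>T\<^esub> x \<oplus>\<^bsub>T\<^esub> (c \<otimes>\<^bsub>T\<^esub> t) \<otimes>\<^bsub>T\<^esub> y) \<ominus>\<^bsub>T\<^esub> c \<otimes>\<^bsub>T\<^esub> x' \<ominus>\<^bsub>T\<^esub> (c \<otimes>\<^bsub>T\<^esub> t) \<otimes>\<^bsub>T\<^esub> y"
      using eq by (simp add: u_def)
    also have "\<dots> = c \<otimes>\<^bsub>T\<^esub> (x \<ominus>\<^bsub>T\<^esub> x')" using xT cT t by algebra
    finally have "(y' \<ominus>\<^bsub>T\<^esub> y) \<otimes>\<^bsub>T\<^esub> t = x \<ominus>\<^bsub>T\<^esub> x'"
      using T.non_zero_divisor_cancel[OF c(1)] xT t by simp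
    then have "y' \<ominus>\<^bsub>T\<^esub> y \<in> ?J" using x by simp
    then have "s \<otimes>\<^bsub>T\<^esub> (y' \<ominus>\<^bsub>T\<^esub> y) \<in> K" using JK s K.I_l_closed by blast
    moreover have "s \<otimes>\<^bsub>T\<^esub> (y' \<ominus>\<^bsub>T\<^esub> y) = s \<otimes>\<^bsub>T\<^esub> y' \<ominus>\<^bsub>T\<^esub> s \<otimes>\<^bsub>T\<^esub> y" using s xT by algebra
    ultimately show ?thesis using T.quotient_eq_iff_same_a_r_cos[OF idK] s xT by simp
  qed
  have b: "b s (copy_of (c \<otimes>\<^bsub>T\<^esub> x \<oplus>\<^bsub>T\<^esub> u \<otimes>\<^bsub>T\<^esub> y)) = K +>\<^bsub>T\<^esub> (s \<otimes>\<^bsub>T\<^esub> y)"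
    if s: "s \<in> carrier T" "x \<in> carrier R" "y \<in> carrier R" for s x y
  proof -
    let ?n = "c \<otimes>\<^bsub>T\<^esub> x \<oplus>\<^bsub>T\<^esub> u \<otimes>\<^bsub>T\<^esub> y"
    obtain x' where "x' \<in> carrier R" "?n = c \<otimes>\<^bsub>T\<^esub> x' \<oplus>\<^bsub>T\<^esub> u \<otimes>\<^bsub>T\<^esub> y_of ?n" "y_of ?n \<in> carrier R"
      using y_of[OF U_I[OF s(2,3)]] by blast
    then show ?thesis using coset[OF s(1,2,3), of x' "y_of ?n"] by (simp add: b_def)
  qed
  have cosum: "K +>\<^bsub>T\<^esub> (p \<oplus>\<^bsub>T\<^esub> q) = (K +>\<^bsub>T\<^esub> p) \<oplus>\<^bsub>T Quot K\<^esub> (K +>\<^bsub>T\<^esub> q)"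
    if "p \<in> carrier T" "q \<in> carrier T" for p q
    using ring_hom_memE(3)[OF K.rcos_ring_hom that] .
  have coclosed: "K +>\<^bsub>T\<^esub> p \<in> carrier (T Quot K)" if "p \<in> carrier T" for p
    using ring_hom_memE(1)[OF K.rcos_ring_hom that] .
  have UE: thesis if "Y \<in> copy_of ` U"
    "\<And>x y. x \<in> carrier R \<Longrightarrow> y \<in> carrier R \<Longrightarrow> Y = copy_of (c \<otimes>\<^bsub>T\<^esub> x \<oplus>\<^bsub>T\<^esub> u \<otimes>\<^bsub>T\<^esub> y) \<Longrightarrow> thesis" for Y thesis
    using that unfolding U_def by blast
  let ?M = "mult_module T (carrier T)" and ?N = "copy_module R U" and ?N' = "copy_module R (carrier R)"
  have M: "module R ?M" using flat by (simp add: flat_module_def)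
  have N: "module R ?N" by (rule module_copy_module[OF cring_R U])
  have N': "module R ?N'" by (rule module_copy_module[OF cring_R R.oneideal])
  have M_simps: "carrier ?M = carrier T" "\<And>x y. x \<oplus>\<^bsub>?M\<^esub> y = x \<oplus>\<^bsub>T\<^esub> y" "\<And>r x. r \<odot>\<^bsub>?M\<^esub> x = r \<otimes>\<^bsub>T\<^esub> x"
    by (simp_all add: mult_module_def)
  interpret Q: ring "T Quot K" by (rule K.quotient_is_ring)
  have "\<exists>h\<in>hom (free_Abelian_group (carrier ?M \<times> carrier ?N)) (add_monoid (T Quot K)).
    (\<forall>x\<in>carrier ?M. \<forall>y\<in>carrier ?N. h (frag_of (x, y)) = b x y) \<and>
    (\<forall>v\<in>tensor_subgroup R ?M ?N. h v = \<one>\<^bsub>add_monoid (T Quot K)\<^esub>)"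
  proof (rule balanced_map_extends[OF M N Q.a_comm_group, of b])
    fix s Y assume "s \<in> carrier ?M" "Y \<in> carrier ?N"
    then have s: "s \<in> carrier T" and Y: "Y \<in> copy_of ` U" by (auto simp: M_simps)
    show "b s Y \<in> carrier (add_monoid (T Quot K))"
      using Y s by (elim UE) (use s R_subset in \<open>simp add: b coclosed\<close>)
  next
    fix s s' Y assume "s \<in> carrier ?M" "s' \<in> carrier ?M" "Y \<in> carrier ?N"
    then have s: "s \<in> carrier T" "s' \<in> carrier T" and Y: "Y \<in> copy_of ` U" by (auto simp: M_simps)
    show "b (s \<oplus>\<^bsub>?M\<^esub> s') Y = b s Y \<otimes>\<^bsub>add_monoid (T Quot K)\<^esub> b s' Y"
      using Y s by (elim UE) (use s R_subset in \<open>simp add: M_simps b T.l_distr cosum\<close>)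
  next
    fix s Y Y' assume "s \<in> carrier ?M" "Y \<in> carrier ?N" "Y' \<in> carrier ?N"
    then have s: "s \<in> carrier T" and Y: "Y \<in> copy_of ` U" and Y': "Y' \<in> copy_of ` U" by (auto simp: M_simps)
    from Y show "b s (Y \<oplus>\<^bsub>?N\<^esub> Y') = b s Y \<otimes>\<^bsub>add_monoid (T Quot K)\<^esub> b s Y'"
    proof (rule UE)
      fix x y assume 1: "x \<in> carrier R" "y \<in> carrier R" "Y = copy_of (c \<otimes>\<^bsub>T\<^esub> x \<oplus>\<^bsub>T\<^esub> u \<otimes>\<^bsub>T\<^esub> y)"
      from Y' show ?thesis
      proof (rule UE)
        fix x' y' assume 2: "x' \<in> carrier R" "y' \<in> carrier R" "Y' = copy_of (c \<otimes>\<^bsub>T\<^esub> x' \<oplus>\<^bsub>T\<^esub> u \<otimes>\<^bsub>T\<^esub> y')"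
        show ?thesis using 1 2 s R_subset by (simp add: U_add b cosum T.r_distr)
      qed
    qed
  next
    fix r s Y assume r: "r \<in> carrier R" and "s \<in> carrier ?M" "Y \<in> carrier ?N"
    then have s: "s \<in> carrier T" and Y: "Y \<in> copy_of ` U" by (auto simp: M_simps)
    from Y show "b (r \<odot>\<^bsub>?M\<^esub> s) Y = b s (r \<odot>\<^bsub>?N\<^esub> Y)"
      by (rule UE) (use r s R_subset in \<open>simp add: M_simps U_mult b T.m_ac\<close>)
  qed
  then obtain h where h: "h \<in> hom (free_Abelian_group (carrier ?M \<times> carrier ?N)) (add_monoid (T Quot K))"
    "\<And>x y. x \<in> carrier ?M \<Longrightarrow> y \<in> carrier ?N \<Longrightarrow> h (frag_of (x, y)) = b x y"
    "\<And>v. v \<in> tensor_subgroup R ?M ?N \<Longrightarrow> h v = \<one>\<^bsub>add_monoid (T Quot K)\<^esub>"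
    by blast
  interpret h: group_hom "free_Abelian_group (carrier ?M \<times> carrier ?N)" "add_monoid (T Quot K)" h
    by (intro group_hom.intro group_hom_axioms.intro group_free_Abelian_group Q.a_group h(1))
  \<comment> \<open>In these representations the coefficients of \<open>u\<close> are 0 and 1. Hence
    \<open>b\<close> sends \<open>(t, c)\<close> to the class of 0 and \<open>(1, u)\<close> to the
    class of 1, and equating the two puts 1 in \<open>K\<close>.\<close>
  have ceq: "c = c \<otimes>\<^bsub>T\<^esub> \<one>\<^bsub>T\<^esub> \<oplus>\<^bsub>T\<^esub> u \<otimes>\<^bsub>T\<^esub> \<zero>\<^bsub>T\<^esub>" and ueq: "u = c \<otimes>\<^bsub>T\<^esub> \<zero>\<^bsub>T\<^esub> \<oplus>\<^bsub>T\<^esub> u \<otimes>\<^bsub>T\<^esub> \<one>\<^bsub>T\<^esub>"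
    using cT R_subset[OF uR] by simp_all
  have cU: "c \<in> U" by (subst ceq) (rule U_I, simp_all)
  have uU: "u \<in> U" by (subst ueq) (rule U_I, simp_all)
  define v where "v = frag_of (t, copy_of c) - frag_of (\<one>\<^bsub>T\<^esub>, copy_of u)"
  have one': "copy_of \<one>\<^bsub>T\<^esub> \<in> carrier ?N'" by simp
  have rel: "frag_of (r \<otimes>\<^bsub>T\<^esub> s, copy_of \<one>\<^bsub>T\<^esub>) - frag_of (s, copy_of r) \<in> tensor_subgroup R ?M ?N'"
    if "r \<in> carrier R" "s \<in> carrier T" for r s
  proof -
    have "frag_of (r \<odot>\<^bsub>?M\<^esub> s, copy_of \<one>\<^bsub>T\<^esub>) - frag_of (s, r \<odot>\<^bsub>?N'\<^esub> copy_of \<one>\<^bsub>T\<^esub>) \<in> tensor_relations R ?M ?N'"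
      unfolding tensor_relations_def
      by (intro UnI2 CollectI, rule exI[of _ r], rule exI[of _ s], rule exI[of _ "copy_of \<one>\<^bsub>T\<^esub>"])
        (use that one' in \<open>simp add: M_simps\<close>)
    then show ?thesis using that R_subset by (auto simp: M_simps tensor_subgroup_def intro: generate.incl)
  qed
  \<comment> \<open>Over all of \<open>R\<close> the scalars \<open>u\<close> and \<open>c\<close>
    can be moved to the left factor, where both tensors become that of \<open>c t = u\<close> with
    1.\<close>
  have "v = (frag_of (u \<otimes>\<^bsub>T\<^esub> \<one>\<^bsub>T\<^esub>, copy_of \<one>\<^bsub>T\<^esub>) - frag_of (\<one>\<^bsub>T\<^esub>, copy_of u)) +
      - (frag_of (c \<otimes>\<^bsub>T\<^esub> t, copy_of \<one>\<^bsub>T\<^esub>) - frag_of (t, copy_of c))"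
    using cT t by (simp add: v_def u_def)
  also have "\<dots> \<in> tensor_subgroup R ?M ?N'"
    using rel[OF uR] rel[OF c(2) t] by (intro tensor_subgroup_closed[OF M N']) auto
  finally have "v \<in> tensor_subgroup R ?M ?N'" .
  moreover have keys: "Poly_Mapping.keys v \<subseteq> carrier ?M \<times> carrier ?N"
    using keys_diff[of "frag_of (t, copy_of c)" "frag_of (\<one>\<^bsub>T\<^esub>, copy_of u)"] t cU uU
    by (auto simp: v_def M_simps)
  ultimately have "v \<in> tensor_subgroup R ?M ?N"
    using UR by (intro flat_module_submodule[OF flat N N']) (auto simp: copy_module_def)
  then have hv: "h v = \<zero>\<^bsub>T Quot K\<^esub>" using h(3) by simp
  have fr: "frag_of (\<one>\<^bsub>T\<^esub>, copy_of u) \<in> carrier (free_Abelian_group (carrier ?M \<times> carrier ?N))"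
    using uU by (simp add: M_simps)
  have "K +>\<^bsub>T\<^esub> (t \<otimes>\<^bsub>T\<^esub> \<zero>\<^bsub>T\<^esub>) = b t (copy_of c)" by (subst ceq) (use b[OF t] in simp)
  also have "\<dots> = h (frag_of (t, copy_of c))" using h(2) t cU by (simp add: M_simps)
  also have "\<dots> = h (v + frag_of (\<one>\<^bsub>T\<^esub>, copy_of u))" by (simp add: v_def)
  also have "\<dots> = h v \<oplus>\<^bsub>T Quot K\<^esub> h (frag_of (\<one>\<^bsub>T\<^esub>, copy_of u))"
    using h.hom_mult[OF _ fr, of v] keys by simp
  also have "\<dots> = h (frag_of (\<one>\<^bsub>T\<^esub>, copy_of u))" using h.hom_closed[OF fr] hv by simp
  also have "\<dots> = b \<one>\<^bsub>T\<^esub> (copy_of u)" using h(2) uU by (simp add: M_simps)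
  also have "\<dots> = K +>\<^bsub>T\<^esub> (\<one>\<^bsub>T\<^esub> \<otimes>\<^bsub>T\<^esub> \<one>\<^bsub>T\<^esub>)" by (subst ueq) (use b in simp)
  finally have "K +>\<^bsub>T\<^esub> \<one>\<^bsub>T\<^esub> = K +>\<^bsub>T\<^esub> \<zero>\<^bsub>T\<^esub>" using t by simp
  then have "\<one>\<^bsub>T\<^esub> \<ominus>\<^bsub>T\<^esub> \<zero>\<^bsub>T\<^esub> \<in> K" using T.quotient_eq_iff_same_a_r_cos[OF idK] by simp
  then have "\<one>\<^bsub>T\<^esub> \<in> K" by (simp add: a_minus_def)
  then show ?thesis using K.one_imp_carrier by (simp add: K_def)
qed

end

section \<open>Comaximal families\<close>

text \<open>The multipliers sending \<open>w\<close> into \<open>J\<close> form an ideal; if it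
  contains a comaximal family, it contains 1. Most membership proofs below are reduced to the
  members of such a family in this way.\<close>

lemma (in cring) mem_ideal_if_comaximal:
  assumes J: "ideal J R" and Z: "Z \<subseteq> carrier R" "Idl Z = carrier R" and w: "w \<in> carrier R"
    and mem: "\<And>z. z \<in> Z \<Longrightarrow> w \<otimes> z \<in> J"
  shows "w \<in> J"
proof -
  interpret J: ideal J R by (rule J)
  have "ideal {s \<in> carrier R. w \<otimes> s \<in> J} R"
    by (rule ideal_criterion) (use w J.I_l_closed in \<open>auto simp: r_distr m_lcomm[of w]\<close>)
  moreover have "Z \<subseteq> {s \<in> carrier R. w \<otimes> s \<in> J}" using Z mem by auto
  ultimately have "Idl Z \<subseteq> {s \<in> carrier R. w \<otimes> s \<in> J}" by (rule genideal_minimal)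
  then have "\<one> \<in> {s \<in> carrier R. w \<otimes> s \<in> J}" using Z(2) by blast
  then show ?thesis using w by simp
qed

lemma (in cring) finitely_generated_PIdl:
  "a \<in> carrier R \<Longrightarrow> finitely_generated_ideal (PIdl a) R"
  unfolding finitely_generated_ideal_def by (intro exI[of _ "{a}"]) (simp add: cgenideal_eq_genideal)

context ring_hom_cring
begin

lemma image_ideal:
  assumes surj: "h ` carrier R = carrier S" and I: "ideal I R"
  shows "ideal (h ` I) S"
proof -
  interpret I: ideal I R by (rule I)
  show ?thesis
  proof (rule S.ideal_criterion)
    show "h ` I \<subseteq> carrier S" using I.Icarr by auto
    show "\<zero>\<^bsub>S\<^esub> \<in> h ` I" using I.zero_closed hom_zero by (metis image_eqI)
  next
    fix x y assume "x \<in> h ` I" "y \<in> h ` I"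
    then obtain a b where "a \<in> I" "b \<in> I" "x = h a" "y = h b" by auto
    then show "x \<oplus>\<^bsub>S\<^esub> y \<in> h ` I" using I.Icarr by (auto intro!: image_eqI[of _ _ "a \<oplus> b"])
  next
    fix r x assume "r \<in> carrier S" "x \<in> h ` I"
    then obtain s a where "s \<in> carrier R" "a \<in> I" "r = h s" "x = h a" using surj by blast
    then show "r \<otimes>\<^bsub>S\<^esub> x \<in> h ` I"
      using I.Icarr I.I_l_closed by (auto intro!: image_eqI[of _ _ "s \<otimes> a"])
  qed
qed

text \<open>Used to lift elements of an ideal generated by residue classes to an ideal upstairs that
  contains representatives of the generators.\<close>

lemma genideal_image_subset:
  assumes surj: "h ` carrier R = carrier S" and I: "ideal I R" and Z: "Z \<subseteq> I"
  shows "Idl\<^bsub>S\<^esub> (h ` Z) \<subseteq> h ` I"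
  by (rule S.genideal_minimal[OF image_ideal[OF surj I]]) (use Z in blast)

end

section \<open>Ideals isomorphic to ideals comaximal in the overring\<close>

text \<open>The hypothesis of the theorem on finitely generated ideals, in a form that can be passed
  to lemmas.\<close>

definition ideals_comaximal_up_to_iso :: "'a ring \<Rightarrow> 'a ring \<Rightarrow> bool" where
  "ideals_comaximal_up_to_iso R T \<longleftrightarrow>
     (\<forall>I. finitely_generated_ideal I R \<and> I \<noteq> {\<zero>\<^bsub>R\<^esub>} \<longrightarrow>
        (\<exists>I'. ideal I' R \<and> module_isomorphic R (mult_module R I') (mult_module R I) \<and>
              Idl\<^bsub>T\<^esub> I' = carrier T))"

context ring_extension
begin

lemma comaximal_up_to_isoE:
  assumes "ideals_comaximal_up_to_iso R T" "finite F" "F \<subseteq> carrier R" "\<not> F \<subseteq> {\<zero>\<^bsub>T\<^esub>}"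
  obtains I' f where "ideal I' R" "Idl\<^bsub>T\<^esub> I' = carrier T" "bij_betw f I' (Idl\<^bsub>R\<^esub> F)"
    "\<And>x y. x \<in> I' \<Longrightarrow> y \<in> I' \<Longrightarrow> f (x \<oplus>\<^bsub>T\<^esub> y) = f x \<oplus>\<^bsub>T\<^esub> f y"
    "\<And>r x. r \<in> carrier R \<Longrightarrow> x \<in> I' \<Longrightarrow> f (r \<otimes>\<^bsub>T\<^esub> x) = r \<otimes>\<^bsub>T\<^esub> f x"
proof -
  have "finitely_generated_ideal (Idl\<^bsub>R\<^esub> F) R"
    using assms(2,3) by (auto simp: finitely_generated_ideal_def)
  moreover have "Idl\<^bsub>R\<^esub> F \<noteq> {\<zero>\<^bsub>R\<^esub>}" using R.genideal_self[OF assms(3)] assms(4) by auto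
  ultimately obtain I' where "ideal I' R" "Idl\<^bsub>T\<^esub> I' = carrier T"
      "module_isomorphic R (mult_module R I') (mult_module R (Idl\<^bsub>R\<^esub> F))"
    using assms(1) unfolding ideals_comaximal_up_to_iso_def by blast
  then show thesis
    using that unfolding module_isomorphic_def module_hom_def mult_module_def by auto
qed

text \<open>An element killing \<open>x\<close> kills the principal ideal of \<open>x\<close>, hence
  the isomorphic ideal \<open>I'\<close>. Since \<open>I'\<close> generates the unit ideal of
  \<open>T\<close>, it is zero.\<close>

lemma subring_no_zero_divisors:
  assumes rep: "ideals_comaximal_up_to_iso R T"
    and x: "x \<in> carrier R" "x \<noteq> \<zero>\<^bsub>T\<^esub>" and y: "y \<in> carrier R" and yx: "y \<otimes>\<^bsub>T\<^esub> x = \<zero>\<^bsub>T\<^esub>"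
  shows "y = \<zero>\<^bsub>T\<^esub>"
proof -
  obtain I' f where I': "ideal I' R" "Idl\<^bsub>T\<^esub> I' = carrier T" "bij_betw f I' (Idl\<^bsub>R\<^esub> {x})"
    and lin: "\<And>r x. r \<in> carrier R \<Longrightarrow> x \<in> I' \<Longrightarrow> f (r \<otimes>\<^bsub>T\<^esub> x) = r \<otimes>\<^bsub>T\<^esub> f x"
  proof -
    have "finite {x}" "{x} \<subseteq> carrier R" "\<not> {x} \<subseteq> {\<zero>\<^bsub>T\<^esub>}" using x by auto
    from comaximal_up_to_isoE[OF rep this] that show thesis by metis
  qed
  interpret I': ideal I' R by (rule I')
  have "y \<in> {\<zero>\<^bsub>T\<^esub>}"
  proof (rule T.mem_ideal_if_comaximal[OF T.zeroideal _ I'(2)])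
    fix z assume z: "z \<in> I'"
    then have "f z \<in> PIdl\<^bsub>R\<^esub> x" using I'(3) R.cgenideal_eq_genideal[OF x(1)] by (auto simp: bij_betw_def)
    then obtain r where r: "r \<in> carrier R" "f z = r \<otimes>\<^bsub>T\<^esub> x" by (auto simp: R.cgenideal_iff)
    have "y \<otimes>\<^bsub>T\<^esub> f z = r \<otimes>\<^bsub>T\<^esub> (y \<otimes>\<^bsub>T\<^esub> x)" using r x y R_subset by (simp add: T.m_lcomm)
    then have "f (y \<otimes>\<^bsub>T\<^esub> z) = \<zero>\<^bsub>T\<^esub>" using lin[OF y z] yx R_subset[OF r(1)] by simp
    moreover have "f \<zero>\<^bsub>T\<^esub> = \<zero>\<^bsub>T\<^esub>"
      using lin[OF R.zero_closed z] z I'.Icarr R_subset r x by simp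
    moreover have "y \<otimes>\<^bsub>T\<^esub> z \<in> I'" "\<zero>\<^bsub>T\<^esub> \<in> I'" using I'.I_l_closed[OF z y] I'.zero_closed by simp_all
    ultimately have "y \<otimes>\<^bsub>T\<^esub> z = \<zero>\<^bsub>T\<^esub>" using I'(3) unfolding bij_betw_def inj_on_def by metis
    then show "y \<otimes>\<^bsub>T\<^esub> z \<in> {\<zero>\<^bsub>T\<^esub>}" by simp
  qed (use I'.Icarr R_subset y in auto)
  then show ?thesis by simp
qed

text \<open>Take for \<open>g\<close> the inverse of the isomorphism from \<open>I'\<close> to the
  ideal of \<open>F\<close>. By linearity both \<open>x \<otimes> g y\<close> and
  \<open>y \<otimes> g x\<close> are the value of \<open>g\<close> at the product of
  \<open>x\<close> and \<open>y\<close>, and \<open>g\<close> maps generators to generators of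
  \<open>I'\<close>, which is comaximal in \<open>T\<close>.\<close>

lemma comaximal_proportional_family:
  assumes rep: "ideals_comaximal_up_to_iso R T" and F: "finite F" "F \<subseteq> carrier R" "\<not> F \<subseteq> {\<zero>\<^bsub>T\<^esub>}"
  obtains g where "\<And>x. x \<in> F \<Longrightarrow> g x \<in> carrier R"
    "\<And>x y. x \<in> F \<Longrightarrow> y \<in> F \<Longrightarrow> x \<otimes>\<^bsub>T\<^esub> g y = y \<otimes>\<^bsub>T\<^esub> g x"
    "Idl\<^bsub>T\<^esub> (g ` F) = carrier T"
proof -
  obtain I' f where I': "ideal I' R" "Idl\<^bsub>T\<^esub> I' = carrier T" "bij_betw f I' (Idl\<^bsub>R\<^esub> F)"
    and add: "\<And>x y. x \<in> I' \<Longrightarrow> y \<in> I' \<Longrightarrow> f (x \<oplus>\<^bsub>T\<^esub> y) = f x \<oplus>\<^bsub>T\<^esub> f y"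
    and lin: "\<And>r x. r \<in> carrier R \<Longrightarrow> x \<in> I' \<Longrightarrow> f (r \<otimes>\<^bsub>T\<^esub> x) = r \<otimes>\<^bsub>T\<^esub> f x"
    using comaximal_up_to_isoE[OF rep F] by metis
  interpret I': ideal I' R by (rule I')
  interpret I: ideal "Idl\<^bsub>R\<^esub> F" R by (rule R.genideal_ideal[OF F(2)])
  define g where "g = the_inv_into I' f"
  have gf: "g (f a) = a" if "a \<in> I'" for a
    using I'(3) that by (simp add: g_def bij_betw_def the_inv_into_f_f)
  have g: "g x \<in> I'" "f (g x) = x" if x: "x \<in> Idl\<^bsub>R\<^esub> F" for x
  proof -
    obtain a where "a \<in> I'" "x = f a" using I'(3) x by (auto simp: bij_betw_def)
    then show "g x \<in> I'" "f (g x) = x" using gf by simp_all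
  qed
  have glin: "g (r \<otimes>\<^bsub>T\<^esub> x) = r \<otimes>\<^bsub>T\<^esub> g x" if "r \<in> carrier R" "x \<in> Idl\<^bsub>R\<^esub> F" for r x
    using gf[of "r \<otimes>\<^bsub>T\<^esub> g x"] lin[OF that(1) g(1)] g that I'.I_l_closed by simp
  have gadd: "g (x \<oplus>\<^bsub>T\<^esub> y) = g x \<oplus>\<^bsub>T\<^esub> g y" if "x \<in> Idl\<^bsub>R\<^esub> F" "y \<in> Idl\<^bsub>R\<^esub> F" for x y
    using gf[of "g x \<oplus>\<^bsub>T\<^esub> g y"] add g that I'.a_closed by simp
  have FI: "F \<subseteq> Idl\<^bsub>R\<^esub> F" by (rule R.genideal_self[OF F(2)])
  have gT: "g ` F \<subseteq> carrier T" using g(1) FI I'.Icarr R_subset by blast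
  show thesis
  proof (rule that[of g])
    show "g x \<in> carrier R" if "x \<in> F" for x using g(1) FI I'.Icarr that by blast
    show "x \<otimes>\<^bsub>T\<^esub> g y = y \<otimes>\<^bsub>T\<^esub> g x" if xy: "x \<in> F" "y \<in> F" for x y
    proof -
      have "x \<otimes>\<^bsub>T\<^esub> g y = g (x \<otimes>\<^bsub>T\<^esub> y)" using glin xy F(2) FI by (simp add: subset_iff)
      also have "\<dots> = g (y \<otimes>\<^bsub>T\<^esub> x)" using xy F(2) R_subset by (simp add: T.m_comm subset_iff)
      also have "\<dots> = y \<otimes>\<^bsub>T\<^esub> g x" using glin xy F(2) FI by (simp add: subset_iff)
      finally show ?thesis .
    qed
    interpret G: ideal "Idl\<^bsub>T\<^esub> (g ` F)" T by (rule T.genideal_ideal[OF gT])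
    have "ideal {x \<in> Idl\<^bsub>R\<^esub> F. g x \<in> Idl\<^bsub>T\<^esub> (g ` F)} R"
    proof (rule R.ideal_criterion)
      have "g \<zero>\<^bsub>T\<^esub> = \<zero>\<^bsub>T\<^esub>"
        using glin[OF R.zero_closed I.zero_closed] g(1)[OF I.zero_closed] I'.Icarr R_subset by simp
      then show "\<zero>\<^bsub>R\<^esub> \<in> {x \<in> Idl\<^bsub>R\<^esub> F. g x \<in> Idl\<^bsub>T\<^esub> (g ` F)}"
        using I.zero_closed G.zero_closed by simp
    qed (use I.Icarr I.a_closed I.I_l_closed gadd glin G.a_closed G.I_l_closed R_subset in auto)
    moreover have "F \<subseteq> {x \<in> Idl\<^bsub>R\<^esub> F. g x \<in> Idl\<^bsub>T\<^esub> (g ` F)}"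
      using FI T.genideal_self[OF gT] by auto
    ultimately have *: "Idl\<^bsub>R\<^esub> F \<subseteq> {x \<in> Idl\<^bsub>R\<^esub> F. g x \<in> Idl\<^bsub>T\<^esub> (g ` F)}" by (rule R.genideal_minimal)
    have "I' \<subseteq> Idl\<^bsub>T\<^esub> (g ` F)"
    proof
      fix a assume a: "a \<in> I'"
      then have "f a \<in> Idl\<^bsub>R\<^esub> F" using I'(3) by (auto simp: bij_betw_def)
      then show "a \<in> Idl\<^bsub>T\<^esub> (g ` F)" using * gf[OF a] by auto
    qed
    then have "Idl\<^bsub>T\<^esub> I' \<subseteq> Idl\<^bsub>T\<^esub> (g ` F)" by (rule T.genideal_minimal[OF G.ideal_axioms])
    then show "Idl\<^bsub>T\<^esub> (g ` F) = carrier T" using I'(2) G.Icarr by blast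
  qed
qed

end

section \<open>Intersections of principal ideals\<close>

lemma (in cring) cgenideal_zero: "PIdl \<zero> = {\<zero>}"
  by (auto simp: cgenideal_iff intro!: exI[of _ \<zero>])

context conductor_square
begin

sublocale ring_extension R T
  by (intro ring_extension.intro ring_extension_axioms.intro R_subring R_operations T.is_cring)

lemma C_carrier: "x \<in> C \<Longrightarrow> x \<in> carrier R"
  by (rule ideal.Icarr[OF C_common(1)])

text \<open>Multiplying by \<open>c \<in> C\<close> moves \<open>x\<close> and \<open>y\<close> into
  \<open>R\<close>, where a comaximal pair \<open>p\<close>, \<open>q\<close> with
  \<open>x q = y p\<close> exists. If \<open>w = a x = b y\<close>, then \<open>w q\<close> and
  \<open>w p\<close> are multiples of \<open>d = x q\<close>, so \<open>w\<close> is one by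
  comaximality.\<close>

lemma intersection_two_principal:
  assumes rep: "ideals_comaximal_up_to_iso R T"
    and c: "non_zero_divisor T c" "c \<in> C"
    and nzd: "\<And>x y. x \<in> carrier T \<Longrightarrow> y \<in> carrier T \<Longrightarrow> y \<otimes>\<^bsub>T\<^esub> x = \<zero>\<^bsub>T\<^esub> \<Longrightarrow> x \<noteq> \<zero>\<^bsub>T\<^esub> \<Longrightarrow> y = \<zero>\<^bsub>T\<^esub>"
    and x: "x \<in> carrier T" and y: "y \<in> carrier T"
  shows "\<exists>d\<in>carrier T. PIdl\<^bsub>T\<^esub> x \<inter> PIdl\<^bsub>T\<^esub> y = PIdl\<^bsub>T\<^esub> d"
proof (cases "x = \<zero>\<^bsub>T\<^esub>")
  case True
  interpret Y: ideal "PIdl\<^bsub>T\<^esub> y" T by (rule T.cgenideal_ideal[OF y])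
  have "PIdl\<^bsub>T\<^esub> x = {\<zero>\<^bsub>T\<^esub>}" using True T.cgenideal_zero by simp
  then show ?thesis using x Y.zero_closed by (intro bexI[of _ x]) auto
next
  case False
  interpret C: ideal C T by (rule C_common(2))
  have cT: "c \<in> carrier T" using c C.Icarr by simp
  have car: "c \<otimes>\<^bsub>T\<^esub> x \<in> carrier R" "c \<otimes>\<^bsub>T\<^esub> y \<in> carrier R" using c x y C.I_r_closed C_carrier by auto
  \<comment> \<open>A proportional comaximal family is available only for a family that is not
    entirely zero, hence the separate case \<open>x = 0\<close>.\<close>
  have "c \<otimes>\<^bsub>T\<^esub> x \<noteq> \<zero>\<^bsub>T\<^esub>" using False c x T.m_comm[OF cT x] by (auto simp: non_zero_divisor_def)
  then have F: "finite {c \<otimes>\<^bsub>T\<^esub> x, c \<otimes>\<^bsub>T\<^esub> y}" "{c \<otimes>\<^bsub>T\<^esub> x, c \<otimes>\<^bsub>T\<^esub> y} \<subseteq> carrier R" "\<not> {c \<otimes>\<^bsub>T\<^esub> x, c \<otimes>\<^bsub>T\<^esub> y} \<subseteq> {\<zero>\<^bsub>T\<^esub>}"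
    using car by auto
  obtain g where g: "\<And>a. a \<in> {c \<otimes>\<^bsub>T\<^esub> x, c \<otimes>\<^bsub>T\<^esub> y} \<Longrightarrow> g a \<in> carrier R"
    "\<And>a b. a \<in> {c \<otimes>\<^bsub>T\<^esub> x, c \<otimes>\<^bsub>T\<^esub> y} \<Longrightarrow> b \<in> {c \<otimes>\<^bsub>T\<^esub> x, c \<otimes>\<^bsub>T\<^esub> y} \<Longrightarrow> a \<otimes>\<^bsub>T\<^esub> g b = b \<otimes>\<^bsub>T\<^esub> g a"
    "Idl\<^bsub>T\<^esub> (g ` {c \<otimes>\<^bsub>T\<^esub> x, c \<otimes>\<^bsub>T\<^esub> y}) = carrier T"
    using comaximal_proportional_family[OF rep F] by metis
  define p q where "p = g (c \<otimes>\<^bsub>T\<^esub> x)" and "q = g (c \<otimes>\<^bsub>T\<^esub> y)"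
  have pq: "p \<in> carrier T" "q \<in> carrier T" using g(1) R_subset by (auto simp: p_def q_def)
  have "c \<otimes>\<^bsub>T\<^esub> (x \<otimes>\<^bsub>T\<^esub> q) = c \<otimes>\<^bsub>T\<^esub> (y \<otimes>\<^bsub>T\<^esub> p)"
    using g(2)[of "c \<otimes>\<^bsub>T\<^esub> x" "c \<otimes>\<^bsub>T\<^esub> y"] pq cT x y by (simp add: T.m_assoc flip: p_def q_def)
  then have d: "x \<otimes>\<^bsub>T\<^esub> q = y \<otimes>\<^bsub>T\<^esub> p" using T.non_zero_divisor_cancel[OF c(1)] pq x y by simp
  let ?d = "x \<otimes>\<^bsub>T\<^esub> q"
  have dT: "?d \<in> carrier T" using x pq by simp
  have "PIdl\<^bsub>T\<^esub> x \<inter> PIdl\<^bsub>T\<^esub> y = PIdl\<^bsub>T\<^esub> ?d"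
  proof (intro equalityI subsetI)
    fix w assume "w \<in> PIdl\<^bsub>T\<^esub> x \<inter> PIdl\<^bsub>T\<^esub> y"
    then obtain a b where ab: "a \<in> carrier T" "b \<in> carrier T" "w = a \<otimes>\<^bsub>T\<^esub> x" "w = b \<otimes>\<^bsub>T\<^esub> y"
      by (auto simp: T.cgenideal_iff)
    show "w \<in> PIdl\<^bsub>T\<^esub> ?d"
    proof (rule T.mem_ideal_if_comaximal[OF T.cgenideal_ideal[OF dT] _ g(3)])
      fix z assume "z \<in> g ` {c \<otimes>\<^bsub>T\<^esub> x, c \<otimes>\<^bsub>T\<^esub> y}"
      then consider "z = p" | "z = q" by (auto simp: p_def q_def)
      then show "w \<otimes>\<^bsub>T\<^esub> z \<in> PIdl\<^bsub>T\<^esub> ?d"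
      proof cases
        case 1
        have "w \<otimes>\<^bsub>T\<^esub> z = b \<otimes>\<^bsub>T\<^esub> ?d" unfolding 1 d ab(4) using ab(2) pq y by (simp add: T.m_assoc)
        then show ?thesis using ab by (auto simp: T.cgenideal_iff)
      next
        case 2
        have "w \<otimes>\<^bsub>T\<^esub> z = a \<otimes>\<^bsub>T\<^esub> ?d" unfolding 2 ab(3) using ab(1) pq x by (simp add: T.m_assoc)
        then show ?thesis using ab by (auto simp: T.cgenideal_iff)
      qed
    qed (use pq ab x in \<open>auto simp: p_def q_def\<close>)
  next
    fix w assume "w \<in> PIdl\<^bsub>T\<^esub> ?d"
    then obtain s where s: "s \<in> carrier T" "w = s \<otimes>\<^bsub>T\<^esub> ?d" by (auto simp: T.cgenideal_iff)
    have "w = (s \<otimes>\<^bsub>T\<^esub> q) \<otimes>\<^bsub>T\<^esub> x" using s x pq by (simp add: T.m_ac)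
    moreover have "w = (s \<otimes>\<^bsub>T\<^esub> p) \<otimes>\<^bsub>T\<^esub> y" using s(1) y pq unfolding s(2) d by (simp add: T.m_ac)
    moreover have "s \<otimes>\<^bsub>T\<^esub> q \<in> carrier T" "s \<otimes>\<^bsub>T\<^esub> p \<in> carrier T" using s pq by simp_all
    ultimately show "w \<in> PIdl\<^bsub>T\<^esub> x \<inter> PIdl\<^bsub>T\<^esub> y" unfolding T.cgenideal_iff Int_iff by blast
  qed
  then show ?thesis using dT by blast
qed

end

lemma (in cring) finite_intersection_principal:
  assumes two: "\<And>x y. x \<in> carrier R \<Longrightarrow> y \<in> carrier R \<Longrightarrow> \<exists>d\<in>carrier R. PIdl x \<inter> PIdl y = PIdl d"
    and "finite F" "F \<noteq> {}" "F \<subseteq> carrier R"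
  shows "\<exists>d\<in>carrier R. (\<Inter>a\<in>F. PIdl a) = PIdl d"
  using assms(2-4)
proof (induction F rule: finite_ne_induct)
  case (singleton x)
  then show ?case by auto
next
  case (insert x F)
  then obtain d where "d \<in> carrier R" "(\<Inter>a\<in>F. PIdl a) = PIdl d" by auto
  then show ?case using two[of x d] insert.prems by auto
qed

text \<open>Without zero-divisors an annihilator is zero or the whole ring, and an intersection
  involving the zero ideal is zero. Only intersections of non-zero principal ideals remain.\<close>

lemma (in cring) quasi_coherent_if_no_zero_divisors:
  assumes nzd: "\<And>x y. x \<in> carrier R \<Longrightarrow> y \<in> carrier R \<Longrightarrow> y \<otimes> x = \<zero> \<Longrightarrow> x \<noteq> \<zero> \<Longrightarrow> y = \<zero>"
    and inter: "\<And>F. finite F \<Longrightarrow> F \<noteq> {} \<Longrightarrow> F \<subseteq> carrier R - {\<zero>} \<Longrightarrow>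
        finitely_generated_ideal (\<Inter>a\<in>F. PIdl a) R"
  shows "quasi_coherent R"
  unfolding quasi_coherent_def
proof (intro conjI ballI allI impI)
  fix a assume a: "a \<in> carrier R"
  have "annihilator R a = (if a = \<zero> then PIdl \<one> else PIdl \<zero>)"
  proof (cases "a = \<zero>")
    case True
    then show ?thesis by (auto simp: annihilator_def cgenideal_iff)
  next
    case False
    have "annihilator R a = {\<zero>}" using nzd[OF a _ _ False] a by (auto simp: annihilator_def)
    then show ?thesis using False cgenideal_zero by simp
  qed
  then show "finitely_generated_ideal (annihilator R a) R"
    using finitely_generated_PIdl[of \<one>] finitely_generated_PIdl[of \<zero>] by simp
next
  fix F assume F: "finite F \<and> F \<noteq> {} \<and> F \<subseteq> carrier R"
  show "finitely_generated_ideal (\<Inter>a\<in>F. PIdl a) R"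
  proof (cases "\<zero> \<in> F")
    case True
    have "\<zero> \<in> PIdl a" if "a \<in> F" for a
      using F that by (auto simp: cgenideal_iff intro!: bexI[of _ \<zero>])
    then have "(\<Inter>a\<in>F. PIdl a) = PIdl \<zero>" using True cgenideal_zero
      by (intro equalityI INT_lower INT_greatest) auto
    then show ?thesis using finitely_generated_PIdl[of \<zero>] by simp
  qed (use inter F in blast)
qed

section \<open>Intersections of principal ideals of the subring\<close>

context conductor_square
begin

lemma quotient_eq_iff:
  assumes "x \<in> carrier R" "y \<in> carrier R"
  shows "C +>\<^bsub>R\<^esub> x = C +>\<^bsub>R\<^esub> y \<longleftrightarrow> x \<ominus>\<^bsub>T\<^esub> y \<in> C"
proof -
  \<comment> \<open>Negation in \<open>R\<close> is defined by a description over
    \<open>carrier R\<close>; uniqueness of negatives identifies it with negation in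
    \<open>T\<close>.\<close>
  have neg: "\<ominus>\<^bsub>R\<^esub> y = \<ominus>\<^bsub>T\<^esub> y"
    using R.minus_equality[of "\<ominus>\<^bsub>T\<^esub> y" y] assms(2) R_subset by (simp add: T.l_neg)
  then show ?thesis
    using R.quotient_eq_iff_same_a_r_cos[OF C_common(1) assms] by (simp add: a_minus_def)
qed

text \<open>
  If \<open>x z\<^sub>x = D\<close> for all \<open>x \<in> F\<close>, the intersection of the \<open>x R\<close> is \<open>D M\<close> where \<open>M\<close> consists of
  the \<open>m \<in> T\<close> such that \<open>m z\<^sub>x \<in> R\<close> for all \<open>x\<close>. Since \<open>1 \<in> M\<close>, it suffices to generate \<open>M\<close>
  modulo \<open>C\<close>. An element \<open>Z\<close> of the ideal of the \<open>z\<^sub>x\<close> which is regular modulo \<open>C\<close> embeds \<open>M / C\<close>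
  into \<open>A\<close>, with image the colon ideal of the \<open>z\<^sub>x\<close> into \<open>Z A\<close>.
\<close>

lemma finitely_generated_intersection:
  assumes F: "finite F" "F \<noteq> {}" "F \<subseteq> carrier R"
    and F_nzd: "\<And>x. x \<in> F \<Longrightarrow> non_zero_divisor T x"
    and z: "\<And>x. x \<in> F \<Longrightarrow> z x \<in> carrier R" "\<And>x. x \<in> F \<Longrightarrow> x \<otimes>\<^bsub>T\<^esub> z x = D"
    and comax: "Idl\<^bsub>T\<^esub> (z ` F) = carrier T"
    and denom: "\<And>t. t \<in> carrier T \<Longrightarrow> Idl\<^bsub>T\<^esub> {r \<in> carrier R. r \<otimes>\<^bsub>T\<^esub> t \<in> carrier R} = carrier T"
    and si: "supporting_idempotents (R Quot C)"
    and qc: "quasi_coherent (R Quot C)"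
  shows "finitely_generated_ideal (\<Inter>x\<in>F. PIdl\<^bsub>R\<^esub> x) R"
proof -
  let ?A = "R Quot C" and ?\<eta> = "\<lambda>x. C +>\<^bsub>R\<^esub> x"
  interpret CR: ideal C R by (rule C_common(1))
  interpret CT: ideal C T by (rule C_common(2))
  interpret \<eta>: ring_hom_cring R ?A ?\<eta> by (rule CR.rcos_ring_hom_cring[OF cring_R])
  have surj: "?\<eta> ` carrier R = carrier ?A"
    by (auto simp: FactRing_def A_RCOSETS_def RCOSETS_def a_r_coset_def)
  have FT: "x \<in> carrier T" if "x \<in> F" for x using that F R_subset by blast
  have zT: "z x \<in> carrier T" if "x \<in> F" for x using that z R_subset by blast
  have zF: "z ` F \<subseteq> carrier R" "z ` F \<subseteq> carrier T" using z zT by auto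
  let ?G = "?\<eta> ` z ` F"
  have G: "finite ?G" "?G \<subseteq> carrier ?A" using F zF by auto
  \<comment> \<open>Whatever kills \<open>a\<close> kills the residue classes of all
    \<open>z x\<close>; comaximality will turn this into regularity.\<close>
  obtain a where a: "a \<in> Idl\<^bsub>?A\<^esub> ?G"
    "\<forall>x\<in>carrier ?A. x \<otimes>\<^bsub>?A\<^esub> a = \<zero>\<^bsub>?A\<^esub> \<longrightarrow> (\<forall>g\<in>?G. x \<otimes>\<^bsub>?A\<^esub> g = \<zero>\<^bsub>?A\<^esub>)"
    using \<eta>.S.ideal_element_with_same_annihilator[OF si G] by blast
  have "a \<in> ?\<eta> ` (Idl\<^bsub>R\<^esub> (z ` F))"
    using a(1) \<eta>.genideal_image_subset[OF surj R.genideal_ideal[OF zF(1)] R.genideal_self[OF zF(1)]] by blast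
  then obtain Z where Z: "Z \<in> Idl\<^bsub>R\<^esub> (z ` F)" "a = ?\<eta> Z" by blast
  have ZR: "Z \<in> carrier R" using Z(1) ideal.Icarr[OF R.genideal_ideal[OF zF(1)]] by blast
  then have ZT: "Z \<in> carrier T" by (rule R_subset)
  have \<eta>0: "?\<eta> x = \<zero>\<^bsub>?A\<^esub> \<longleftrightarrow> x \<in> C" if "x \<in> carrier R" for x
    using quotient_eq_iff[OF that R_closed(1)] \<eta>.hom_zero R_subset[OF that] by (simp add: a_minus_def)
  \<comment> \<open>If \<open>r Z \<in> C\<close>, the class of \<open>r\<close> kills
    \<open>a\<close>, hence the classes of all \<open>z x\<close>. So \<open>C\<close> contains
    every \<open>r z x\<close>, and then \<open>r\<close> because the \<open>z x\<close> are
    comaximal in \<open>T\<close>.\<close>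
  have regR: "r \<in> C" if r: "r \<in> carrier R" "r \<otimes>\<^bsub>T\<^esub> Z \<in> C" for r
  proof (rule T.mem_ideal_if_comaximal[OF C_common(2) zF(2) comax R_subset[OF r(1)]])
    fix y assume y: "y \<in> z ` F"
    then have yR: "y \<in> carrier R" using zF by blast
    have "?\<eta> r \<otimes>\<^bsub>?A\<^esub> a = \<zero>\<^bsub>?A\<^esub>" using \<eta>0[of "r \<otimes>\<^bsub>T\<^esub> Z"] r ZR \<eta>.hom_mult[OF r(1) ZR] Z(2) by simp
    then have "?\<eta> r \<otimes>\<^bsub>?A\<^esub> ?\<eta> y = \<zero>\<^bsub>?A\<^esub>" using a(2) y r(1) by blast
    then show "r \<otimes>\<^bsub>T\<^esub> y \<in> C" using \<eta>0[of "r \<otimes>\<^bsub>T\<^esub> y"] r(1) yR \<eta>.hom_mult[OF r(1) yR] by simp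
  qed
  \<comment> \<open>Regularity passes from \<open>R\<close> to \<open>T\<close> through the
    denominators \<open>r\<close> of \<open>t\<close>: each \<open>r t\<close> lies in
    \<open>R\<close>, so \<open>regR\<close> applies to it, and the denominators are comaximal by
    \<open>denom\<close>.\<close>
  have regT: "t \<in> C" if t: "t \<in> carrier T" "t \<otimes>\<^bsub>T\<^esub> Z \<in> C" for t
  proof (rule T.mem_ideal_if_comaximal[OF C_common(2) _ denom[OF t(1)] t(1)])
    fix r assume "r \<in> {r \<in> carrier R. r \<otimes>\<^bsub>T\<^esub> t \<in> carrier R}"
    then have r: "r \<in> carrier R" "r \<otimes>\<^bsub>T\<^esub> t \<in> carrier R" by auto
    have "r \<otimes>\<^bsub>T\<^esub> t \<otimes>\<^bsub>T\<^esub> Z \<in> C"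
      using CT.I_l_closed[OF t(2) R_subset[OF r(1)]] t(1) ZT R_subset[OF r(1)] by (simp add: T.m_assoc)
    then have "r \<otimes>\<^bsub>T\<^esub> t \<in> C" using regR r by blast
    then show "t \<otimes>\<^bsub>T\<^esub> r \<in> C" using t(1) R_subset[OF r(1)] by (simp add: T.m_comm)
  qed (use R_subset in auto)
  have a_nzd: "non_zero_divisor ?A a"
    unfolding non_zero_divisor_def
  proof (intro conjI ballI impI)
    show "a \<in> carrier ?A" using Z(2) ZR by simp
    fix x assume "x \<in> carrier ?A" and xa: "x \<otimes>\<^bsub>?A\<^esub> a = \<zero>\<^bsub>?A\<^esub>"
    then obtain r where r: "r \<in> carrier R" "x = ?\<eta> r" using surj by blast
    then have "r \<otimes>\<^bsub>T\<^esub> Z \<in> C" using xa \<eta>0[of "r \<otimes>\<^bsub>T\<^esub> Z"] ZR Z(2) \<eta>.hom_mult[OF r(1) ZR] by simp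
    then show "x = \<zero>\<^bsub>?A\<^esub>" using regR r \<eta>0 by blast
  qed
  define Y where "Y = {x \<in> carrier ?A. \<forall>g\<in>?G. x \<otimes>\<^bsub>?A\<^esub> g \<in> PIdl\<^bsub>?A\<^esub> a}"
  have "finitely_generated_ideal Y ?A"
    unfolding Y_def by (rule \<eta>.S.finitely_generated_colon[OF qc si a_nzd G])
  then obtain HA where HA: "finite HA" "HA \<subseteq> carrier ?A" "Y = Idl\<^bsub>?A\<^esub> HA"
    by (auto simp: finitely_generated_ideal_def)
  then obtain H where H: "H \<subseteq> carrier R" "finite H" "HA = ?\<eta> ` H"
    using finite_subset_image[OF HA(1)] surj by metis
  have HY: "?\<eta> h \<in> Y" if "h \<in> H" for h using that HA H(3) \<eta>.S.genideal_self[OF HA(2)] by blast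
  \<comment> \<open>Membership in the colon ideal, rewritten as congruences modulo \<open>C\<close>
    between elements of \<open>T\<close>.\<close>
  have Y_iff: "?\<eta> h \<in> Y \<longleftrightarrow> (\<forall>x\<in>F. \<exists>r\<in>carrier R. h \<otimes>\<^bsub>T\<^esub> z x \<ominus>\<^bsub>T\<^esub> r \<otimes>\<^bsub>T\<^esub> Z \<in> C)"
    if h: "h \<in> carrier R" for h
  proof -
    have "?\<eta> h \<otimes>\<^bsub>?A\<^esub> ?\<eta> (z x) \<in> PIdl\<^bsub>?A\<^esub> a \<longleftrightarrow> (\<exists>r\<in>carrier R. h \<otimes>\<^bsub>T\<^esub> z x \<ominus>\<^bsub>T\<^esub> r \<otimes>\<^bsub>T\<^esub> Z \<in> C)"
      if x: "x \<in> F" for x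
    proof -
      have "?\<eta> h \<otimes>\<^bsub>?A\<^esub> ?\<eta> (z x) \<in> PIdl\<^bsub>?A\<^esub> a \<longleftrightarrow> (\<exists>r\<in>carrier R. ?\<eta> h \<otimes>\<^bsub>?A\<^esub> ?\<eta> (z x) = ?\<eta> r \<otimes>\<^bsub>?A\<^esub> ?\<eta> Z)"
        unfolding \<eta>.S.cgenideal_iff Z(2) surj[symmetric] by blast
      also have "\<dots> \<longleftrightarrow> (\<exists>r\<in>carrier R. ?\<eta> (h \<otimes>\<^bsub>T\<^esub> z x) = ?\<eta> (r \<otimes>\<^bsub>T\<^esub> Z))"
        using \<eta>.hom_mult[OF h z(1)[OF x]] \<eta>.hom_mult[OF _ ZR] by simp
      also have "\<dots> \<longleftrightarrow> (\<exists>r\<in>carrier R. h \<otimes>\<^bsub>T\<^esub> z x \<ominus>\<^bsub>T\<^esub> r \<otimes>\<^bsub>T\<^esub> Z \<in> C)"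
        using quotient_eq_iff h z(1)[OF x] ZR by simp
      finally show ?thesis .
    qed
    then show ?thesis using h by (simp add: Y_def)
  qed
  have "\<exists>t\<in>carrier T. h \<ominus>\<^bsub>T\<^esub> t \<otimes>\<^bsub>T\<^esub> Z \<in> C \<and> (\<forall>x\<in>F. t \<otimes>\<^bsub>T\<^esub> z x \<in> carrier R)" if h: "h \<in> H" for h
  proof -
    have hR: "h \<in> carrier R" and hT: "h \<in> carrier T" using h H(1) R_subset by auto
    \<comment> \<open>This is \<open>Z T + C\<close>. It contains every \<open>h z x\<close>, hence
      \<open>h\<close> by comaximality, which gives a \<open>t\<close> with \<open>h\<close>
      congruent to \<open>t Z\<close>; \<open>regT\<close> then yields
      \<open>t z x \<in> R\<close>.\<close>
    let ?J = "{y \<in> carrier T. \<exists>t\<in>carrier T. y \<ominus>\<^bsub>T\<^esub> t \<otimes>\<^bsub>T\<^esub> Z \<in> C}"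
    have J: "ideal ?J T"
    proof (rule T.ideal_criterion)
      have "\<zero>\<^bsub>T\<^esub> \<ominus>\<^bsub>T\<^esub> \<zero>\<^bsub>T\<^esub> \<otimes>\<^bsub>T\<^esub> Z = \<zero>\<^bsub>T\<^esub>" using ZT by algebra
      then show "\<zero>\<^bsub>T\<^esub> \<in> ?J" using CT.zero_closed by (auto intro!: bexI[of _ "\<zero>\<^bsub>T\<^esub>"])
    next
      fix y y' assume "y \<in> ?J" "y' \<in> ?J"
      then obtain t t' where *: "y \<in> carrier T" "y' \<in> carrier T" "t \<in> carrier T" "t' \<in> carrier T"
        "y \<ominus>\<^bsub>T\<^esub> t \<otimes>\<^bsub>T\<^esub> Z \<in> C" "y' \<ominus>\<^bsub>T\<^esub> t' \<otimes>\<^bsub>T\<^esub> Z \<in> C" by auto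
      have "(y \<oplus>\<^bsub>T\<^esub> y') \<ominus>\<^bsub>T\<^esub> (t \<oplus>\<^bsub>T\<^esub> t') \<otimes>\<^bsub>T\<^esub> Z = (y \<ominus>\<^bsub>T\<^esub> t \<otimes>\<^bsub>T\<^esub> Z) \<oplus>\<^bsub>T\<^esub> (y' \<ominus>\<^bsub>T\<^esub> t' \<otimes>\<^bsub>T\<^esub> Z)"
        using *(1-4) ZT by algebra
      then have "(y \<oplus>\<^bsub>T\<^esub> y') \<ominus>\<^bsub>T\<^esub> (t \<oplus>\<^bsub>T\<^esub> t') \<otimes>\<^bsub>T\<^esub> Z \<in> C" using *(5,6) CT.a_closed by simp
      then show "y \<oplus>\<^bsub>T\<^esub> y' \<in> ?J" using * by (blast intro: T.a_closed)
    next
      fix r y assume r: "r \<in> carrier T" and "y \<in> ?J"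
      then obtain t where *: "y \<in> carrier T" "t \<in> carrier T" "y \<ominus>\<^bsub>T\<^esub> t \<otimes>\<^bsub>T\<^esub> Z \<in> C" by auto
      have "r \<otimes>\<^bsub>T\<^esub> y \<ominus>\<^bsub>T\<^esub> (r \<otimes>\<^bsub>T\<^esub> t) \<otimes>\<^bsub>T\<^esub> Z = r \<otimes>\<^bsub>T\<^esub> (y \<ominus>\<^bsub>T\<^esub> t \<otimes>\<^bsub>T\<^esub> Z)"
        using *(1,2) r ZT by algebra
      then have "r \<otimes>\<^bsub>T\<^esub> y \<ominus>\<^bsub>T\<^esub> (r \<otimes>\<^bsub>T\<^esub> t) \<otimes>\<^bsub>T\<^esub> Z \<in> C" using *(3) r CT.I_l_closed by simp
      then show "r \<otimes>\<^bsub>T\<^esub> y \<in> ?J" using * r by (blast intro: T.m_closed)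
    qed auto
    have cond: "\<exists>r\<in>carrier R. h \<otimes>\<^bsub>T\<^esub> z x \<ominus>\<^bsub>T\<^esub> r \<otimes>\<^bsub>T\<^esub> Z \<in> C" if "x \<in> F" for x
      using Y_iff[OF hR] HY[OF h] that by blast
    have "h \<in> ?J"
    proof (rule T.mem_ideal_if_comaximal[OF J zF(2) comax hT])
      fix y assume "y \<in> z ` F"
      then obtain x where x: "x \<in> F" "y = z x" by auto
      then show "h \<otimes>\<^bsub>T\<^esub> y \<in> ?J" using cond[OF x(1)] hT zT R_subset by blast
    qed
    then obtain t where t: "t \<in> carrier T" "h \<ominus>\<^bsub>T\<^esub> t \<otimes>\<^bsub>T\<^esub> Z \<in> C" by auto
    have "t \<otimes>\<^bsub>T\<^esub> z x \<in> carrier R" if x: "x \<in> F" for x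
    proof -
      obtain r where r: "r \<in> carrier R" "h \<otimes>\<^bsub>T\<^esub> z x \<ominus>\<^bsub>T\<^esub> r \<otimes>\<^bsub>T\<^esub> Z \<in> C" using cond[OF x] by blast
      have "(t \<otimes>\<^bsub>T\<^esub> z x \<ominus>\<^bsub>T\<^esub> r) \<otimes>\<^bsub>T\<^esub> Z =
          (h \<otimes>\<^bsub>T\<^esub> z x \<ominus>\<^bsub>T\<^esub> r \<otimes>\<^bsub>T\<^esub> Z) \<ominus>\<^bsub>T\<^esub> z x \<otimes>\<^bsub>T\<^esub> (h \<ominus>\<^bsub>T\<^esub> t \<otimes>\<^bsub>T\<^esub> Z)"
        using t(1) hT ZT zT[OF x] R_subset[OF r(1)] by algebra
      moreover have "z x \<otimes>\<^bsub>T\<^esub> (h \<ominus>\<^bsub>T\<^esub> t \<otimes>\<^bsub>T\<^esub> Z) \<in> C" using CT.I_l_closed[OF t(2) zT[OF x]] .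
      ultimately have "(t \<otimes>\<^bsub>T\<^esub> z x \<ominus>\<^bsub>T\<^esub> r) \<otimes>\<^bsub>T\<^esub> Z \<in> C"
        using r(2) CT.a_closed CT.a_inv_closed by (simp add: a_minus_def)
      moreover have "t \<otimes>\<^bsub>T\<^esub> z x \<ominus>\<^bsub>T\<^esub> r \<in> carrier T" using t(1) zT[OF x] R_subset[OF r(1)] by simp
      ultimately have "t \<otimes>\<^bsub>T\<^esub> z x \<ominus>\<^bsub>T\<^esub> r \<in> carrier R" by (blast intro: regT C_carrier)
      then have "(t \<otimes>\<^bsub>T\<^esub> z x \<ominus>\<^bsub>T\<^esub> r) \<oplus>\<^bsub>T\<^esub> r \<in> carrier R" using r(1) by simp
      moreover have "(t \<otimes>\<^bsub>T\<^esub> z x \<ominus>\<^bsub>T\<^esub> r) \<oplus>\<^bsub>T\<^esub> r = t \<otimes>\<^bsub>T\<^esub> z x"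
        using t(1) zT[OF x] R_subset[OF r(1)] by algebra
      ultimately show ?thesis by simp
    qed
    then show ?thesis using t by blast
  qed
  then obtain \<tau> where \<tau>: "\<And>h. h \<in> H \<Longrightarrow> \<tau> h \<in> carrier T" "\<And>h. h \<in> H \<Longrightarrow> h \<ominus>\<^bsub>T\<^esub> \<tau> h \<otimes>\<^bsub>T\<^esub> Z \<in> C"
    "\<And>h x. h \<in> H \<Longrightarrow> x \<in> F \<Longrightarrow> \<tau> h \<otimes>\<^bsub>T\<^esub> z x \<in> carrier R"
    by metis
  define W where "W = (\<Inter>x\<in>F. PIdl\<^bsub>R\<^esub> x)"
  obtain x0 where x0: "x0 \<in> F" using F by blast
  have DT: "D \<in> carrier T" using z(2)[OF x0] FT[OF x0] zT[OF x0] by auto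
  have idX: "ideal (PIdl\<^bsub>R\<^esub> x) R" if "x \<in> F" for x using R.cgenideal_ideal that F by blast
  have W_id: "ideal W R"
    unfolding W_def by (rule R.i_Intersect[of "(\<lambda>x. PIdl\<^bsub>R\<^esub> x) ` F"]) (use F idX in auto)
  have DW: "D \<otimes>\<^bsub>T\<^esub> t \<in> W" if t: "t \<in> carrier T" "\<And>x. x \<in> F \<Longrightarrow> t \<otimes>\<^bsub>T\<^esub> z x \<in> carrier R" for t
  proof -
    have "D \<otimes>\<^bsub>T\<^esub> t = (t \<otimes>\<^bsub>T\<^esub> z x) \<otimes>\<^bsub>T\<^esub> x" if "x \<in> F" for x
      using z(2)[OF that] FT[OF that] zT[OF that] t(1) by (auto simp: T.m_ac)
    then show ?thesis using t(2) unfolding W_def by (auto simp: R.cgenideal_iff)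
  qed
  have D_in_W: "D \<in> W" using DW[of "\<one>\<^bsub>T\<^esub>"] DT zT z(1) by simp
  \<comment> \<open>The generator \<open>D\<close> comes from \<open>1 \<in> M\<close>. Its
    \<open>R\<close>-multiples include \<open>D C\<close>, so the \<open>\<tau> h\<close> need only
    generate \<open>M\<close> modulo \<open>C\<close>.\<close>
  let ?E = "insert D ((\<lambda>h. D \<otimes>\<^bsub>T\<^esub> \<tau> h) ` H)"
  have EW: "?E \<subseteq> W" using D_in_W DW \<tau>(1,3) by blast
  then have ER: "?E \<subseteq> carrier R" using ideal.Icarr[OF W_id] by blast
  define K where "K = Idl\<^bsub>R\<^esub> ?E"
  interpret K: ideal K R unfolding K_def by (rule R.genideal_ideal[OF ER])
  have EK: "?E \<subseteq> K" unfolding K_def by (rule R.genideal_self[OF ER])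
  have "W \<subseteq> K"
  proof
    fix w assume w: "w \<in> W"
    have wT: "w \<in> carrier T" using w ideal.Icarr[OF W_id] R_subset by blast
    have wx: "\<exists>r\<in>carrier R. w = r \<otimes>\<^bsub>T\<^esub> x" if "x \<in> F" for x
      using w that by (auto simp: W_def R.cgenideal_iff)
    \<comment> \<open>If \<open>w = r x\<close>, then \<open>w z x = r D\<close>; comaximality of
      the \<open>z x\<close> makes \<open>w\<close> itself a multiple of \<open>D\<close> in
      \<open>T\<close>.\<close>
    have "w \<in> PIdl\<^bsub>T\<^esub> D"
    proof (rule T.mem_ideal_if_comaximal[OF T.cgenideal_ideal[OF DT] zF(2) comax wT])
      fix y assume "y \<in> z ` F"
      then obtain x where x: "x \<in> F" "y = z x" by auto
      obtain r where r: "r \<in> carrier R" "w = r \<otimes>\<^bsub>T\<^esub> x" using wx[OF x(1)] by blast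
      have "w \<otimes>\<^bsub>T\<^esub> y = r \<otimes>\<^bsub>T\<^esub> D"
        using z(2)[OF x(1)] R_subset[OF r(1)] FT[OF x(1)] zT[OF x(1)] unfolding x(2) r(2)
        by (simp add: T.m_assoc)
      then show "w \<otimes>\<^bsub>T\<^esub> y \<in> PIdl\<^bsub>T\<^esub> D" using R_subset[OF r(1)] by (auto simp: T.cgenideal_iff)
    qed
    then obtain m where m: "m \<in> carrier T" "w = m \<otimes>\<^bsub>T\<^esub> D" by (auto simp: T.cgenideal_iff)
    have mz: "m \<otimes>\<^bsub>T\<^esub> z x \<in> carrier R" if x: "x \<in> F" for x
    proof -
      obtain r where r: "r \<in> carrier R" "w = r \<otimes>\<^bsub>T\<^esub> x" using wx[OF x] by blast
      have "x \<otimes>\<^bsub>T\<^esub> (m \<otimes>\<^bsub>T\<^esub> z x) = m \<otimes>\<^bsub>T\<^esub> D"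
        using m(1) FT[OF x] zT[OF x] unfolding z(2)[OF x, symmetric] by (simp add: T.m_lcomm)
      also have "\<dots> = x \<otimes>\<^bsub>T\<^esub> r" using r m(2) FT[OF x] R_subset[OF r(1)] by (simp add: T.m_comm)
      finally have "m \<otimes>\<^bsub>T\<^esub> z x = r"
        using T.non_zero_divisor_cancel[OF F_nzd[OF x]] m(1) zT[OF x] R_subset[OF r(1)] by simp
      then show ?thesis using r by simp
    qed
    \<comment> \<open>Multiplication by \<open>m\<close> maps every \<open>z x\<close> into
      \<open>R\<close>, hence also the element \<open>Z\<close> of the ideal they generate.\<close>
    have "ideal {s \<in> carrier R. m \<otimes>\<^bsub>T\<^esub> s \<in> carrier R} R"
      by (rule R.ideal_criterion) (use m(1) R_subset in \<open>auto simp: T.r_distr T.m_lcomm[of m]\<close>)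
    moreover have "z ` F \<subseteq> {s \<in> carrier R. m \<otimes>\<^bsub>T\<^esub> s \<in> carrier R}" using z(1) mz by auto
    ultimately have "Idl\<^bsub>R\<^esub> (z ` F) \<subseteq> {s \<in> carrier R. m \<otimes>\<^bsub>T\<^esub> s \<in> carrier R}" by (rule R.genideal_minimal)
    then have mZ: "m \<otimes>\<^bsub>T\<^esub> Z \<in> carrier R" using Z(1) by blast
    have "?\<eta> (m \<otimes>\<^bsub>T\<^esub> Z) \<in> Y"
      unfolding Y_iff[OF mZ]
    proof
      fix x assume x: "x \<in> F"
      have "(m \<otimes>\<^bsub>T\<^esub> Z) \<otimes>\<^bsub>T\<^esub> z x \<ominus>\<^bsub>T\<^esub> (m \<otimes>\<^bsub>T\<^esub> z x) \<otimes>\<^bsub>T\<^esub> Z = \<zero>\<^bsub>T\<^esub>"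
        using m(1) ZT zT[OF x] by algebra
      then show "\<exists>r\<in>carrier R. (m \<otimes>\<^bsub>T\<^esub> Z) \<otimes>\<^bsub>T\<^esub> z x \<ominus>\<^bsub>T\<^esub> r \<otimes>\<^bsub>T\<^esub> Z \<in> C"
        using mz[OF x] CT.zero_closed by (intro bexI[of _ "m \<otimes>\<^bsub>T\<^esub> z x"]) simp_all
    qed
    \<comment> \<open>The set \<open>L\<close> collects the \<open>r\<close> congruent to some
      \<open>t Z\<close> with \<open>D t\<close> already in \<open>K\<close>. It is an ideal
      containing \<open>H\<close>, so its residue classes exhaust \<open>Y\<close> and in particular
      include that of \<open>m Z\<close>.\<close>
    define L where "L = {r \<in> carrier R. \<exists>t\<in>carrier T. D \<otimes>\<^bsub>T\<^esub> t \<in> K \<and> r \<ominus>\<^bsub>T\<^esub> t \<otimes>\<^bsub>T\<^esub> Z \<in> C}"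
    have L: "ideal L R"
    proof (rule R.ideal_criterion)
      have "\<zero>\<^bsub>T\<^esub> \<ominus>\<^bsub>T\<^esub> \<zero>\<^bsub>T\<^esub> \<otimes>\<^bsub>T\<^esub> Z = \<zero>\<^bsub>T\<^esub>" using ZT by algebra
      then show "\<zero>\<^bsub>R\<^esub> \<in> L" using CT.zero_closed K.zero_closed DT by (auto simp: L_def intro!: bexI[of _ "\<zero>\<^bsub>T\<^esub>"])
    next
      fix y y' assume "y \<in> L" "y' \<in> L"
      then obtain t t' where *: "y \<in> carrier R" "y' \<in> carrier R" "t \<in> carrier T" "t' \<in> carrier T"
        "y \<ominus>\<^bsub>T\<^esub> t \<otimes>\<^bsub>T\<^esub> Z \<in> C" "y' \<ominus>\<^bsub>T\<^esub> t' \<otimes>\<^bsub>T\<^esub> Z \<in> C" "D \<otimes>\<^bsub>T\<^esub> t \<in> K" "D \<otimes>\<^bsub>T\<^esub> t' \<in> K"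
        unfolding L_def by blast
      have "(y \<oplus>\<^bsub>T\<^esub> y') \<ominus>\<^bsub>T\<^esub> (t \<oplus>\<^bsub>T\<^esub> t') \<otimes>\<^bsub>T\<^esub> Z = (y \<ominus>\<^bsub>T\<^esub> t \<otimes>\<^bsub>T\<^esub> Z) \<oplus>\<^bsub>T\<^esub> (y' \<ominus>\<^bsub>T\<^esub> t' \<otimes>\<^bsub>T\<^esub> Z)"
        using *(1,2)[THEN R_subset] *(3,4) ZT by algebra
      then have "(y \<oplus>\<^bsub>T\<^esub> y') \<ominus>\<^bsub>T\<^esub> (t \<oplus>\<^bsub>T\<^esub> t') \<otimes>\<^bsub>T\<^esub> Z \<in> C" using *(5,6) CT.a_closed by simp
      moreover have "D \<otimes>\<^bsub>T\<^esub> (t \<oplus>\<^bsub>T\<^esub> t') \<in> K"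
        using K.a_closed[OF *(7,8)] *(3,4) DT by (simp add: T.r_distr)
      ultimately show "y \<oplus>\<^bsub>R\<^esub> y' \<in> L" using *(1-4) unfolding L_def by (simp, blast intro: T.a_closed)
    next
      fix r y assume r: "r \<in> carrier R" and "y \<in> L"
      then obtain t where *: "y \<in> carrier R" "t \<in> carrier T" "y \<ominus>\<^bsub>T\<^esub> t \<otimes>\<^bsub>T\<^esub> Z \<in> C" "D \<otimes>\<^bsub>T\<^esub> t \<in> K"
        unfolding L_def by blast
      have rT: "r \<in> carrier T" by (rule R_subset[OF r])
      have "r \<otimes>\<^bsub>T\<^esub> y \<ominus>\<^bsub>T\<^esub> (r \<otimes>\<^bsub>T\<^esub> t) \<otimes>\<^bsub>T\<^esub> Z = r \<otimes>\<^bsub>T\<^esub> (y \<ominus>\<^bsub>T\<^esub> t \<otimes>\<^bsub>T\<^esub> Z)"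
        using *(2) R_subset[OF *(1)] rT ZT by algebra
      then have "r \<otimes>\<^bsub>T\<^esub> y \<ominus>\<^bsub>T\<^esub> (r \<otimes>\<^bsub>T\<^esub> t) \<otimes>\<^bsub>T\<^esub> Z \<in> C" using *(3) rT CT.I_l_closed by simp
      moreover have "D \<otimes>\<^bsub>T\<^esub> (r \<otimes>\<^bsub>T\<^esub> t) \<in> K"
        using K.I_l_closed[OF *(4) r] *(2) rT DT by (simp add: T.m_lcomm)
      ultimately show "r \<otimes>\<^bsub>R\<^esub> y \<in> L" using *(1,2) r rT unfolding L_def by (simp, blast intro: T.m_closed)
    qed (auto simp: L_def)
    have "H \<subseteq> L" using H(1) \<tau>(1,2) EK unfolding L_def by blast
    then have "Y \<subseteq> ?\<eta> ` L" unfolding HA(3) H(3) by (rule \<eta>.genideal_image_subset[OF surj L])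
    then obtain r where r: "r \<in> L" "?\<eta> (m \<otimes>\<^bsub>T\<^esub> Z) = ?\<eta> r" using \<open>?\<eta> (m \<otimes>\<^bsub>T\<^esub> Z) \<in> Y\<close> by blast
    then obtain t where t: "r \<in> carrier R" "t \<in> carrier T" "D \<otimes>\<^bsub>T\<^esub> t \<in> K" "r \<ominus>\<^bsub>T\<^esub> t \<otimes>\<^bsub>T\<^esub> Z \<in> C"
      unfolding L_def by blast
    have "m \<otimes>\<^bsub>T\<^esub> Z \<ominus>\<^bsub>T\<^esub> r \<in> C" using r(2) quotient_eq_iff[OF mZ t(1)] by simp
    then have "(m \<otimes>\<^bsub>T\<^esub> Z \<ominus>\<^bsub>T\<^esub> r) \<oplus>\<^bsub>T\<^esub> (r \<ominus>\<^bsub>T\<^esub> t \<otimes>\<^bsub>T\<^esub> Z) \<in> C" using t(4) CT.a_closed by simp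
    moreover have "(m \<otimes>\<^bsub>T\<^esub> Z \<ominus>\<^bsub>T\<^esub> r) \<oplus>\<^bsub>T\<^esub> (r \<ominus>\<^bsub>T\<^esub> t \<otimes>\<^bsub>T\<^esub> Z) = (m \<ominus>\<^bsub>T\<^esub> t) \<otimes>\<^bsub>T\<^esub> Z"
      using m(1) t(2) ZT R_subset[OF t(1)] by algebra
    ultimately have "(m \<ominus>\<^bsub>T\<^esub> t) \<otimes>\<^bsub>T\<^esub> Z \<in> C" by simp
    moreover have "m \<ominus>\<^bsub>T\<^esub> t \<in> carrier T" using m(1) t(2) by simp
    \<comment> \<open>So \<open>m\<close> and \<open>t\<close> differ by an element of
      \<open>C\<close>, in particular of \<open>R\<close>, and \<open>w = (m - t) D + D t\<close>
      lies in \<open>K\<close>.\<close>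
    ultimately have mt: "m \<ominus>\<^bsub>T\<^esub> t \<in> carrier R" by (blast intro: regT C_carrier)
    have "(m \<ominus>\<^bsub>T\<^esub> t) \<otimes>\<^bsub>R\<^esub> D \<in> K" using K.I_l_closed[OF _ mt, of D] EK by blast
    then have "(m \<ominus>\<^bsub>T\<^esub> t) \<otimes>\<^bsub>T\<^esub> D \<oplus>\<^bsub>T\<^esub> D \<otimes>\<^bsub>T\<^esub> t \<in> K" using K.a_closed[OF _ t(3)] by simp
    moreover have "(m \<ominus>\<^bsub>T\<^esub> t) \<otimes>\<^bsub>T\<^esub> D \<oplus>\<^bsub>T\<^esub> D \<otimes>\<^bsub>T\<^esub> t = w"
      using m(1) t(2) DT unfolding m(2) by algebra
    ultimately show "w \<in> K" by simp
  qed
  moreover have "K \<subseteq> W" unfolding K_def by (rule R.genideal_minimal[OF W_id EW])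
  ultimately have "W = Idl\<^bsub>R\<^esub> ?E" by (simp add: K_def)
  moreover have "finite ?E" using H(2) by simp
  ultimately show ?thesis using ER unfolding W_def finitely_generated_ideal_def by blast
qed

end

section \<open>Quasi-coherence of both rings\<close>

theorem theorem6p7:
  fixes R T :: "'a ring" and C :: "'a set" and Ds :: "'d ring list"
  assumes square: "regular_conductor_square R T C"
    and flat: "flat_module R (mult_module T (carrier T))"
    and principal: "principalideal C T"
    and ideals: "\<And>I. finitely_generated_ideal I R \<Longrightarrow> I \<noteq> {\<zero>\<^bsub>R\<^esub>} \<Longrightarrow>
          \<exists>I'. ideal I' R \<and>
               module_isomorphic R (mult_module R I') (mult_module R I) \<and>
               Idl\<^bsub>T\<^esub> I' = carrier T"
    and domains: "\<And>D. D \<in> set Ds \<Longrightarrow> domain D"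
    and product: "(R Quot C) \<simeq> RDirProd_list Ds"
    and A_quasi_coherent: "quasi_coherent (R Quot C)"
  shows "quasi_coherent R \<and> quasi_coherent T"
proof -
  interpret regular_conductor_square R T C by (rule square)
  interpret C: ideal C T by (rule C_common(2))
  have rep: "ideals_comaximal_up_to_iso R T"
    unfolding ideals_comaximal_up_to_iso_def using ideals by blast
  obtain c where c: "c \<in> C" "non_zero_divisor T c" using regular by blast
  have cT: "c \<in> carrier T" by (rule T.non_zero_divisor_closed[OF c(2)])
  have cR: "c \<otimes>\<^bsub>T\<^esub> t \<in> carrier R" if "t \<in> carrier T" for t
    using C.I_r_closed[OF c(1) that] by (rule C_carrier)
  \<comment> \<open>Multiplying both factors by the regular \<open>c \<in> C\<close> moves the
    product into \<open>R\<close>, which has no zero-divisors.\<close>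
  have T_nzd: "y = \<zero>\<^bsub>T\<^esub>" if xy: "x \<in> carrier T" "y \<in> carrier T" "y \<otimes>\<^bsub>T\<^esub> x = \<zero>\<^bsub>T\<^esub>" "x \<noteq> \<zero>\<^bsub>T\<^esub>" for x y
  proof -
    have cancel: "a = \<zero>\<^bsub>T\<^esub>" if "a \<in> carrier T" "c \<otimes>\<^bsub>T\<^esub> a = \<zero>\<^bsub>T\<^esub>" for a
      using T.non_zero_divisor_cancel[OF c(2) that(1) T.zero_closed] that(2) cT by simp
    have "(c \<otimes>\<^bsub>T\<^esub> y) \<otimes>\<^bsub>T\<^esub> (c \<otimes>\<^bsub>T\<^esub> x) = c \<otimes>\<^bsub>T\<^esub> (c \<otimes>\<^bsub>T\<^esub> (y \<otimes>\<^bsub>T\<^esub> x))"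
      using xy(1,2) cT by (simp add: T.m_ac)
    then have "(c \<otimes>\<^bsub>T\<^esub> y) \<otimes>\<^bsub>T\<^esub> (c \<otimes>\<^bsub>T\<^esub> x) = \<zero>\<^bsub>T\<^esub>" using xy(3) cT by simp
    moreover have "c \<otimes>\<^bsub>T\<^esub> x \<noteq> \<zero>\<^bsub>T\<^esub>" using cancel xy by blast
    ultimately have "c \<otimes>\<^bsub>T\<^esub> y = \<zero>\<^bsub>T\<^esub>" using subring_no_zero_divisors[OF rep] cR xy(1,2) by blast
    then show ?thesis using cancel xy(2) by blast
  qed
  then have nzd: "non_zero_divisor T x" if "x \<in> carrier T" "x \<noteq> \<zero>\<^bsub>T\<^esub>" for x
    using that unfolding non_zero_divisor_def by blast
  have "quasi_coherent T"
  proof (rule T.quasi_coherent_if_no_zero_divisors[OF T_nzd])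
    fix F assume F: "finite F" "F \<noteq> {}" "F \<subseteq> carrier T - {\<zero>\<^bsub>T\<^esub>}"
    then have "\<exists>d\<in>carrier T. (\<Inter>a\<in>F. PIdl\<^bsub>T\<^esub> a) = PIdl\<^bsub>T\<^esub> d"
      by (intro T.finite_intersection_principal intersection_two_principal[OF rep c(2,1) T_nzd]) auto
    then show "finitely_generated_ideal (\<Inter>a\<in>F. PIdl\<^bsub>T\<^esub> a) T"
      using T.finitely_generated_PIdl by auto
  qed
  moreover have "quasi_coherent R"
  proof (rule R.quasi_coherent_if_no_zero_divisors)
    fix F assume F: "finite F" "F \<noteq> {}" "F \<subseteq> carrier R - {\<zero>\<^bsub>R\<^esub>}"
    have F_nzd: "non_zero_divisor T x" if "x \<in> F" for x using that F nzd R_subset by auto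
    have "non_zero_divisor R x" if "x \<in> F" for x
      using F_nzd[OF that] that F R_subset by (auto simp: non_zero_divisor_def)
    then obtain P Q where P: "non_zero_divisor R P"
      and Q: "\<And>x. x \<in> F \<Longrightarrow> Q x \<in> carrier R" "\<And>x. x \<in> F \<Longrightarrow> Q x \<otimes>\<^bsub>T\<^esub> x = P"
      using R.common_multiple_with_cofactors[OF F(1), of "\<lambda>x. x"] by auto
    obtain x0 where x0: "x0 \<in> F" using F by blast
    have FR: "x \<in> carrier R" "x \<in> carrier T" "x \<noteq> \<zero>\<^bsub>T\<^esub>" if "x \<in> F" for x
      using F that R_subset by auto
    have QT: "Q x \<in> carrier T" if "x \<in> F" for x using Q(1)[OF that] by (rule R_subset)
    have "\<one>\<^bsub>T\<^esub> \<noteq> \<zero>\<^bsub>T\<^esub>" using T.one_zeroI T.carrier_one_zero FR[OF x0] by blast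
    then have P0: "P \<noteq> \<zero>\<^bsub>T\<^esub>" using P by (auto simp: non_zero_divisor_def)
    have Q0: "Q x \<noteq> \<zero>\<^bsub>T\<^esub>" if "x \<in> F" for x using Q(2)[OF that] P0 FR[OF that] by auto
    \<comment> \<open>The comaximal family is taken proportional to the cofactors \<open>Q x\<close>
      rather than to the \<open>x\<close>: as \<open>Q x\<close> plays the role of
      \<open>P / x\<close>, the product \<open>x g (Q x)\<close> does not depend on
      \<open>x\<close>.\<close>
    have "finite (Q ` F)" "Q ` F \<subseteq> carrier R" "\<not> Q ` F \<subseteq> {\<zero>\<^bsub>T\<^esub>}"
      using F(1) Q(1) Q0[OF x0] x0 by auto
    from comaximal_proportional_family[OF rep this]
    obtain g where g: "\<And>q. q \<in> Q ` F \<Longrightarrow> g q \<in> carrier R"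
      "\<And>p q. p \<in> Q ` F \<Longrightarrow> q \<in> Q ` F \<Longrightarrow> p \<otimes>\<^bsub>T\<^esub> g q = q \<otimes>\<^bsub>T\<^esub> g p"
      "Idl\<^bsub>T\<^esub> (g ` Q ` F) = carrier T" by metis
    have gT: "g (Q x) \<in> carrier T" if "x \<in> F" for x using g(1) that R_subset by blast
    show "finitely_generated_ideal (\<Inter>a\<in>F. PIdl\<^bsub>R\<^esub> a) R"
    proof (rule finitely_generated_intersection[where z = "\<lambda>x. g (Q x)" and D = "x0 \<otimes>\<^bsub>T\<^esub> g (Q x0)"])
      fix x assume x: "x \<in> F"
      \<comment> \<open>After multiplication by \<open>Q x\<close> and \<open>Q x0\<close>, both
        sides contain the factor \<open>P\<close>, and the remaining equality is the proportionality
        of \<open>g\<close> on the cofactors.\<close>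
      have "non_zero_divisor T (Q x \<otimes>\<^bsub>T\<^esub> Q x0)"
        using nzd Q0 QT x x0 by (intro T.non_zero_divisor_mult) auto
      moreover have "(Q x \<otimes>\<^bsub>T\<^esub> Q x0) \<otimes>\<^bsub>T\<^esub> (x \<otimes>\<^bsub>T\<^esub> g (Q x)) =
          (Q x \<otimes>\<^bsub>T\<^esub> Q x0) \<otimes>\<^bsub>T\<^esub> (x0 \<otimes>\<^bsub>T\<^esub> g (Q x0))"
      proof -
        have "(Q x \<otimes>\<^bsub>T\<^esub> Q x0) \<otimes>\<^bsub>T\<^esub> (x \<otimes>\<^bsub>T\<^esub> g (Q x)) = (Q x \<otimes>\<^bsub>T\<^esub> x) \<otimes>\<^bsub>T\<^esub> (Q x0 \<otimes>\<^bsub>T\<^esub> g (Q x))"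
          using QT gT FR x x0 by (simp add: T.m_ac)
        also have "\<dots> = (Q x0 \<otimes>\<^bsub>T\<^esub> x0) \<otimes>\<^bsub>T\<^esub> (Q x \<otimes>\<^bsub>T\<^esub> g (Q x0))"
          using g(2)[of "Q x0" "Q x"] Q(2)[OF x] Q(2)[OF x0] x x0 by simp
        also have "\<dots> = (Q x \<otimes>\<^bsub>T\<^esub> Q x0) \<otimes>\<^bsub>T\<^esub> (x0 \<otimes>\<^bsub>T\<^esub> g (Q x0))"
          using QT gT FR x x0 by (simp add: T.m_ac)
        finally show ?thesis .
      qed
      ultimately show "x \<otimes>\<^bsub>T\<^esub> g (Q x) = x0 \<otimes>\<^bsub>T\<^esub> g (Q x0)"
        using T.non_zero_divisor_cancel gT FR x x0 by simp
    next
      show "Idl\<^bsub>T\<^esub> ((\<lambda>x. g (Q x)) ` F) = carrier T" using g(3) by (simp add: image_image)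
    next
      show "Idl\<^bsub>T\<^esub> {r \<in> carrier R. r \<otimes>\<^bsub>T\<^esub> t \<in> carrier R} = carrier T" if "t \<in> carrier T" for t
        by (rule flat_denominator_ideal[OF flat that c(2) C_carrier[OF c(1)] cR[OF that]])
    next
      have A: "ring (R Quot C)" by (rule ideal.quotient_is_ring[OF C_common(1)])
      have "ring (RDirProd_list Ds)"
        by (rule RDirProd_list_is_ring) (use domains in \<open>auto simp: domain_def cring_def\<close>)
      then show "supporting_idempotents (R Quot C)"
        using supporting_idempotents_iso[OF A _ product] supporting_idempotents_RDirProd_list[OF domains] by blast
    qed (use F FR F_nzd g(1) A_quasi_coherent in auto)
  qed (use T_nzd R_subset in auto)
  ultimately show ?thesis by simp
qed

end
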